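(* For every natural number $m\geq 2$ and every natural number $L$ such that there exist polynomials $P,Q$ of degree at most $[m/2]-1$ for which the planar system $\dot x=P(x,y)$, $\dot y=Q(x,y)$ has at least $L$ hyperbolic limit cycles, one has $N_h(m)\geq L$. In the paper's notation: $N_h(m)\geq \underline{H}_h\left(\left[\frac{m}{2}\right]-1\right)$.
   Context: $[\cdot]$ denotes the integer part. For a polynomial system $\dot x=P(x,y,z)$, $\dot y=Q(x,y,z)$, $\dot z=R(x,y,z)$, let $\tau_h(P,Q,R)$ be its number of normally hyperbolic invariant tori, and define $N_h(m):=\sup\{\tau_h(P,Q,R):\deg P,\deg Q,\deg R\le m\}$ (possibly $+\infty$). For planar polynomial systems $\dot x=P(x,y)$, $\dot y=Q(x,y)$, let $\pi_h(P,Q)$ be the number of hyperbolic limit cycles and $H_h(k):=\sup\{\pi_h(P,Q):\deg P,\deg Q\le k\}$; $\underline{H}_h(k)$ denotes any finite lower bound for $H_h(k)$. *)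

theory Defs
  imports "HOL-Analysis.Analysis" "HOL-Library.Extended_Nat"
begin

definition poly2_deg_le :: "nat \<Rightarrow> (real \<Rightarrow> real \<Rightarrow> real) \<Rightarrow> bool" where
  "poly2_deg_le k P \<longleftrightarrow> (\<exists>c :: nat \<Rightarrow> nat \<Rightarrow> real.
     \<forall>x y. P x y = (\<Sum>i\<le>k. \<Sum>j\<le>k - i. c i j * x ^ i * y ^ j))"

definition poly3_deg_le :: "nat \<Rightarrow> (real \<Rightarrow> real \<Rightarrow> real \<Rightarrow> real) \<Rightarrow> bool" where
  "poly3_deg_le k P \<longleftrightarrow> (\<exists>c :: nat \<Rightarrow> nat \<Rightarrow> nat \<Rightarrow> real.
     \<forall>x y z. P x y z = (\<Sum>i\<le>k. \<Sum>j\<le>k - i. \<Sum>l\<le>k - i - j. c i j l * x ^ i * y ^ j * z ^ l))"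

definition field2 :: "(real \<Rightarrow> real \<Rightarrow> real) \<Rightarrow> (real \<Rightarrow> real \<Rightarrow> real) \<Rightarrow> real^2 \<Rightarrow> real^2" where
  "field2 P Q v = (\<chi> i. if i = 1 then P (v$1) (v$2) else Q (v$1) (v$2))"

definition field3 :: "(real \<Rightarrow> real \<Rightarrow> real \<Rightarrow> real) \<Rightarrow> (real \<Rightarrow> real \<Rightarrow> real \<Rightarrow> real)
    \<Rightarrow> (real \<Rightarrow> real \<Rightarrow> real \<Rightarrow> real) \<Rightarrow> real^3 \<Rightarrow> real^3" where
  "field3 P Q R v = (\<chi> i. if i = 1 then P (v$1) (v$2) (v$3)
                          else if i = 2 then Q (v$1) (v$2) (v$3) else R (v$1) (v$2) (v$3))"

definition ode_sol :: "(real^'n \<Rightarrow> real^'n) \<Rightarrow> (real \<Rightarrow> real^'n) \<Rightarrow> bool" where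
  "ode_sol F g \<longleftrightarrow> (\<forall>t. (g has_vector_derivative F (g t)) (at t))"

definition variational :: "(real^'n \<Rightarrow> real^'n) \<Rightarrow> (real \<Rightarrow> real^'n) \<Rightarrow> (real \<Rightarrow> real^'n^'n) \<Rightarrow> bool" where
  "variational F g Y \<longleftrightarrow> Y 0 = mat 1 \<and>
     (\<forall>t. (Y has_vector_derivative (matrix (frechet_derivative F (at (g t))) ** Y t)) (at t))"

definition periodic_param :: "(real^'n \<Rightarrow> real^'n) \<Rightarrow> (real^'n) set \<Rightarrow> (real \<Rightarrow> real^'n) \<Rightarrow> real \<Rightarrow> bool" where
  "periodic_param F Orb g T \<longleftrightarrow> ode_sol F g \<and> T > 0 \<and> (\<forall>t. g (t + T) = g t) \<and>
     (\<forall>s. 0 < s \<and> s < T \<longrightarrow> g s \<noteq> g 0) \<and> Orb = range g"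

definition periodic_orbit :: "(real^'n \<Rightarrow> real^'n) \<Rightarrow> (real^'n) set \<Rightarrow> bool" where
  "periodic_orbit F Orb \<longleftrightarrow> (\<exists>g T. periodic_param F Orb g T)"

definition limit_cycle :: "(real^'n \<Rightarrow> real^'n) \<Rightarrow> (real^'n) set \<Rightarrow> bool" where
  "limit_cycle F Orb \<longleftrightarrow> periodic_orbit F Orb \<and>
     (\<exists>U. open U \<and> Orb \<subseteq> U \<and>
        (\<forall>Orb'. periodic_orbit F Orb' \<and> Orb' \<subseteq> U \<longrightarrow> Orb' = Orb))"

(* planar hyperbolic limit cycle: the characteristic multipliers (roots of the characteristic
   polynomial of the monodromy matrix Y T) are the trivial one 1 and mu with |mu| \<noteq> 1 *)
definition hyperbolic_limit_cycle :: "(real^2 \<Rightarrow> real^2) \<Rightarrow> (real^2) set \<Rightarrow> bool" where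
  "hyperbolic_limit_cycle F Orb \<longleftrightarrow> limit_cycle F Orb \<and>
     (\<exists>g T Y mu. periodic_param F Orb g T \<and> variational F g Y \<and> \<bar>mu\<bar> \<noteq> 1 \<and>
        (\<forall>s::real. det (s *\<^sub>R mat 1 - Y T) = (s - 1) * (s - mu)))"

definition ecount :: "'a set \<Rightarrow> enat" where
  "ecount A = (if finite A then enat (card A) else \<infinity>)"

definition pi_h :: "(real \<Rightarrow> real \<Rightarrow> real) \<Rightarrow> (real \<Rightarrow> real \<Rightarrow> real) \<Rightarrow> enat" where
  "pi_h P Q = ecount {Orb. hyperbolic_limit_cycle (field2 P Q) Orb}"

(* C^1 embedded 2-torus: e is a C^1 immersion R^2 \<rightarrow> R^3, Z^2-periodic and injective modulo Z^2 *)
definition torus_param :: "(real^2 \<Rightarrow> real^3) \<Rightarrow> (real^2 \<Rightarrow> real^2 \<Rightarrow> real^3) \<Rightarrow> bool" where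
  "torus_param e De \<longleftrightarrow> (\<forall>u. (e has_derivative De u) (at u)) \<and>
     continuous_on UNIV (\<lambda>u. matrix (De u)) \<and> (\<forall>u. inj (De u)) \<and>
     (\<forall>u v. e u = e v \<longleftrightarrow> (\<forall>i. u$i - v$i \<in> \<int>))"

definition direct_sum3 :: "(real^3) set \<Rightarrow> (real^3) set \<Rightarrow> (real^3) set \<Rightarrow> bool" where
  "direct_sum3 A B C \<longleftrightarrow>
     (\<forall>a\<in>A. \<forall>b\<in>B. \<forall>c\<in>C. a + b + c = 0 \<longrightarrow> a = 0 \<and> b = 0 \<and> c = 0) \<and>
     (\<forall>x. \<exists>a\<in>A. \<exists>b\<in>B. \<exists>c\<in>C. x = a + b + c)"

(* normally hyperbolic invariant torus (Fenichel / Hirsch-Pugh-Shub, flow version):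
   compact invariant C^1 torus with an invariant splitting
   R^3 = T_p Tor + Es p + Eu p, exponential contraction on Es (forward) and Eu (backward)
   at rate b, dominating the tangential rate a < b in both time directions *)
definition nh_invariant_torus :: "(real^3 \<Rightarrow> real^3) \<Rightarrow> (real^3) set \<Rightarrow> bool" where
  "nh_invariant_torus F Tor \<longleftrightarrow> (\<exists>e De. torus_param e De \<and> Tor = range e \<and>
     (\<forall>p\<in>Tor. \<exists>g Y. ode_sol F g \<and> g 0 = p \<and> range g \<subseteq> Tor \<and> variational F g Y) \<and>
     (let Tan = (\<lambda>p. {w. \<exists>u. e u = p \<and> w \<in> range (De u)}) in
      \<exists>Es Eu C a b. C \<ge> 1 \<and> 0 < a \<and> a < b \<and>
       (\<forall>p\<in>Tor. subspace (Es p) \<and> subspace (Eu p) \<and> direct_sum3 (Tan p) (Es p) (Eu p)) \<and>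
       (\<forall>p\<in>Tor. \<forall>g Y. ode_sol F g \<and> g 0 = p \<and> variational F g Y \<longrightarrow>
          (\<forall>t. (\<lambda>v. Y t *v v) ` Es p = Es (g t) \<and> (\<lambda>v. Y t *v v) ` Eu p = Eu (g t)) \<and>
          (\<forall>t\<ge>0. \<forall>v\<in>Es p. norm (Y t *v v) \<le> C * exp (- b * t) * norm v) \<and>
          (\<forall>t\<ge>0. \<forall>v\<in>Eu p. norm (Y (- t) *v v) \<le> C * exp (- b * t) * norm v) \<and>
          (\<forall>t\<ge>0. \<forall>w\<in>Tan p. exp (- a * t) * norm w \<le> C * norm (Y t *v w) \<and>
                              exp (- a * t) * norm w \<le> C * norm (Y (- t) *v w)))))"

definition tau_h :: "(real \<Rightarrow> real \<Rightarrow> real \<Rightarrow> real) \<Rightarrow> (real \<Rightarrow> real \<Rightarrow> real \<Rightarrow> real)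
    \<Rightarrow> (real \<Rightarrow> real \<Rightarrow> real \<Rightarrow> real) \<Rightarrow> enat" where
  "tau_h P Q R = ecount {Tor. nh_invariant_torus (field3 P Q R) Tor}"

definition N_h :: "nat \<Rightarrow> enat" where
  "N_h m = Sup {tau_h P Q R | P Q R. poly3_deg_le m P \<and> poly3_deg_le m Q \<and> poly3_deg_le m R}"

end

theory Submission
  imports Defs
begin

text \<open>
  Choose \<open>K\<close> with \<open>u + K > 0\<close> on finitely many given limit cycles of the planar field \<open>(P, Q)\<close> in the
  coordinates \<open>(u, z)\<close>, and put \<open>u = x\<^sup>2 + y\<^sup>2 - K\<close>. The field
  \<open>x' = - y + x P(u, z)\<close>, \<open>y' = x + y P(u, z)\<close>, \<open>z' = 2 (x\<^sup>2 + y\<^sup>2) Q(u, z)\<close> rotates with angular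
  velocity 1 and satisfies \<open>u' = \<rho> P\<close>, \<open>z' = \<rho> Q\<close> with \<open>\<rho> = 2 (u + K) = 2 (x\<^sup>2 + y\<^sup>2)\<close>; on \<open>u + K > 0\<close> this
  is the planar field up to a change of time. So every planar cycle lifts to an invariant torus of
  revolution, different cycles having different tori.

  On the torus the flow is quasi-periodic, so tangent vectors are neither contracted nor expanded.
  The normal bundle is a line: if \<open>n\<close> solves the planar variational equation with multiplier
  \<open>\<mu>\<close>, adding the right multiple of the field compensates the change of time and gives a
  solution with the same multiplier of the time-changed equation. It decays or grows like
  \<open>\<bar>\<mu>\<bar> powr (t / T)\<close> in the planar time \<open>t\<close>, hence exponentially because \<open>\<rho>\<close> is bounded below on the cycle.
\<close>

section \<open>Uniqueness for ordinary differential equations\<close>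

text \<open>Cauchy-Schwarz is applied row by row, since the norm on matrices is the Frobenius
  norm.\<close>

lemma norm_matrix_vector_mult_le: "norm ((A :: real^'n^'m) *v x) \<le> norm A * norm x"
proof -
  have "norm (A *v x) = L2_set (\<lambda>i. norm ((A *v x) $ i)) UNIV"
    by (simp add: norm_vec_def)
  also have "\<dots> \<le> L2_set (\<lambda>i. norm (A $ i) * norm x) UNIV"
    by (intro L2_set_mono) (simp_all add: matrix_mult_dot Cauchy_Schwarz_ineq2)
  also have "\<dots> = norm A * norm x"
    by (simp add: L2_set_left_distrib norm_vec_def)
  finally show ?thesis .
qed

lemma has_derivative_componentwise_cart:
  fixes g :: "'b::real_normed_vector \<Rightarrow> 'a::euclidean_space^'n"
  shows "(g has_derivative g') (at x) \<longleftrightarrow> (\<forall>i. ((\<lambda>x. g x $ i) has_derivative (\<lambda>h. g' h $ i)) (at x))"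
proof
  assume "(g has_derivative g') (at x)"
  thus "\<forall>i. ((\<lambda>x. g x $ i) has_derivative (\<lambda>h. g' h $ i)) (at x)"
    by (auto intro!: bounded_linear.has_derivative[OF bounded_linear_vec_nth])
next
  assume *: "\<forall>i. ((\<lambda>x. g x $ i) has_derivative (\<lambda>h. g' h $ i)) (at x)"
  show "(g has_derivative g') (at x)"
    unfolding has_derivative_componentwise_within[of g]
  proof
    fix b :: "'a^'n" assume "b \<in> Basis"
    then obtain i u where b: "b = axis i u" "u \<in> Basis"
      by (auto simp: Basis_vec_def)
    have "((\<lambda>x. (g x $ i) \<bullet> u) has_derivative (\<lambda>h. (g' h $ i) \<bullet> u)) (at x)"
      using * by (auto intro!: derivative_eq_intros)
    thus "((\<lambda>x. g x \<bullet> b) has_derivative (\<lambda>h. g' h \<bullet> b)) (at x)"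
      by (simp add: b inner_axis)
  qed
qed

lemma has_vector_derivative_componentwise_cart:
  fixes g :: "real \<Rightarrow> 'a::euclidean_space^'n"
  shows "(g has_vector_derivative d) (at t) \<longleftrightarrow> (\<forall>i. ((\<lambda>t. g t $ i) has_vector_derivative d $ i) (at t))"
  unfolding has_vector_derivative_def by (subst has_derivative_componentwise_cart) simp

lemma ode_sol_componentwise:
  "ode_sol F g \<longleftrightarrow> (\<forall>t i. ((\<lambda>t. g t $ i) has_real_derivative F (g t) $ i) (at t))"
  by (simp add: ode_sol_def has_vector_derivative_componentwise_cart
      has_real_derivative_iff_has_vector_derivative)

text \<open>Gronwall's argument for the squared norm: its derivative is at most \<open>2 * M\<close>
  times itself in absolute value, so an exponential weight makes it monotone on the way from
  \<open>a\<close> to \<open>t\<close>. Since it vanishes at \<open>a\<close>, it cannot be positive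
  at \<open>t\<close>. Both uniqueness lemmas rest on this.\<close>

lemma zero_if_derivative_bounded_by_self:
  fixes D :: "real \<Rightarrow> 'a::real_inner"
  assumes D0: "D a = 0"
    and D': "\<And>t. (D has_vector_derivative D' t) (at t)"
    and bd: "\<And>t. \<bar>t - a\<bar> \<le> B \<Longrightarrow> norm (D' t) \<le> M * norm (D t)"
    and t: "\<bar>t - a\<bar> \<le> B"
  shows "D t = 0"
proof -
  have key: "\<bar>2 * (D t \<bullet> D' t)\<bar> \<le> 2 * M * (D t \<bullet> D t)" if "\<bar>t - a\<bar> \<le> B" for t
  proof -
    have "\<bar>D t \<bullet> D' t\<bar> \<le> norm (D t) * norm (D' t)" by (rule Cauchy_Schwarz_ineq2)
    also have "\<dots> \<le> norm (D t) * (M * norm (D t))"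
      using bd[OF that] by (simp add: mult_left_mono)
    also have "\<dots> = M * (D t \<bullet> D t)" by (simp add: dot_square_norm power2_eq_square)
    finally show ?thesis by simp
  qed
  have der: "((\<lambda>t. (D t \<bullet> D t) * exp (c * t)) has_real_derivative
      (2 * (D t \<bullet> D' t) + c * (D t \<bullet> D t)) * exp (c * t)) (at t)" for c t
    using D'[of t] unfolding has_vector_derivative_def has_field_derivative_def
    by (auto intro!: derivative_eq_intros simp: inner_commute algebra_simps)
  \<comment> \<open>The sign of the weight depends on the side of \<open>a\<close>: damping to the
    right, growth to the left.\<close>
  have "(D t \<bullet> D t) * exp (s * t) \<le> (D a \<bullet> D a) * exp (s * a)"
    if s: "s = (if a \<le> t then - 2 * M else 2 * M)" for s
  proof (cases "a \<le> t")
    case True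
    show ?thesis
    proof (rule DERIV_nonpos_imp_nonincreasing[OF True])
      fix x assume x: "a \<le> x" "x \<le> t"
      hence "2 * (D x \<bullet> D' x) + s * (D x \<bullet> D x) \<le> 0"
        using key[of x] t True s by (auto simp: abs_le_iff)
      thus "\<exists>y. ((\<lambda>t. (D t \<bullet> D t) * exp (s * t)) has_real_derivative y) (at x) \<and> y \<le> 0"
        using der[where c=s and t=x] by (meson exp_ge_zero mult_nonpos_nonneg)
    qed
  next
    case False
    hence "t \<le> a" by simp
    thus ?thesis
    proof (rule DERIV_nonneg_imp_nondecreasing)
      fix x assume x: "t \<le> x" "x \<le> a"
      hence "2 * (D x \<bullet> D' x) + s * (D x \<bullet> D x) \<ge> 0"
        using key[of x] t False s by (auto simp: abs_le_iff)
      thus "\<exists>y. ((\<lambda>t. (D t \<bullet> D t) * exp (s * t)) has_real_derivative y) (at x) \<and> y \<ge> 0"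
        using der[where c=s and t=x] by (meson exp_ge_zero mult_nonneg_nonneg)
    qed
  qed
  hence "(D t \<bullet> D t) * exp ((if a \<le> t then - 2 * M else 2 * M) * t) \<le> 0" using D0 by auto
  hence "D t \<bullet> D t \<le> 0" by (simp add: mult_le_0_iff)
  thus ?thesis using inner_ge_zero[of "D t"] by (metis inner_eq_zero_iff order_antisym)
qed

lemma has_vector_derivative_matrix_vector_mult:
  fixes Y :: "real \<Rightarrow> real^'n^'m"
  assumes "(Y has_vector_derivative Y') (at t)"
  shows "((\<lambda>t. Y t *v v) has_vector_derivative Y' *v v) (at t)"
proof -
  have "linear (\<lambda>A :: real^'n^'m. A *v v)"
    by (rule linearI) (simp_all add: matrix_vector_mult_add_rdistrib scaleR_matrix_vector_assoc)
  from bounded_linear.has_vector_derivative[OF linear_conv_bounded_linear[THEN iffD1, OF this] assms]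
  show ?thesis .
qed

definition C1_field :: "(real^'n \<Rightarrow> real^'n) \<Rightarrow> (real^'n \<Rightarrow> real^'n^'n) \<Rightarrow> bool" where
  "C1_field F A \<longleftrightarrow> continuous_on UNIV A \<and> (\<forall>x. (F has_derivative (*v) (A x)) (at x))"

lemma C1_field_jacobian: "C1_field F A \<Longrightarrow> matrix (frechet_derivative F (at x)) = A x"
  unfolding C1_field_def by (metis frechet_derivative_at matrix_of_matrix_vector_mul)

text \<open>The difference solves the same linear equation, and the coefficient matrix is bounded on
  the compact interval around \<open>a\<close> that reaches \<open>t\<close>.\<close>

lemma linear_ode_unique:
  fixes A :: "real \<Rightarrow> real^'n^'n"
  assumes A: "continuous_on UNIV A"
    and x: "\<And>t. (x has_vector_derivative A t *v x t) (at t)"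
    and y: "\<And>t. (y has_vector_derivative A t *v y t) (at t)"
    and a: "x a = y a"
  shows "x t = y t"
proof -
  define B where "B = \<bar>t - a\<bar>"
  have "compact (A ` cball a B)"
    using A by (intro compact_continuous_image) (auto intro: continuous_on_subset)
  then obtain M where M: "\<And>s. s \<in> cball a B \<Longrightarrow> norm (A s) \<le> M"
    by (meson bounded_iff compact_imp_bounded image_eqI)
  have "x t - y t = 0"
  proof (rule zero_if_derivative_bounded_by_self)
    show "((\<lambda>t. x t - y t) has_vector_derivative (A t *v (x t - y t))) (at t)" for t
      using has_vector_derivative_diff[OF x y] by (simp add: matrix_vector_mult_diff_distrib)
    show "norm (A s *v (x s - y s)) \<le> M * norm (x s - y s)" if "\<bar>s - a\<bar> \<le> B" for s
    proof -
      have "norm (A s) \<le> M" using M[of s] that by (simp add: dist_real_def abs_minus_commute)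
      thus ?thesis
        using norm_matrix_vector_mult_le[of "A s" "x s - y s"]
        by (meson mult_right_mono norm_ge_zero order_trans)
    qed
  qed (use a in \<open>auto simp: B_def\<close>)
  thus ?thesis by simp
qed

lemma ode_sol_continuous_on: "ode_sol F g \<Longrightarrow> continuous_on S g"
  unfolding ode_sol_def
  by (meson continuous_at_imp_continuous_on has_vector_derivative_continuous)

text \<open>The field need only be locally Lipschitz. Over a compact time interval both trajectories
  stay in one ball, which is convex, so a bound for the Jacobian there is a Lipschitz
  constant.\<close>

lemma ode_sol_unique:
  assumes F: "C1_field F A" and x: "ode_sol F x" and y: "ode_sol F y" and a: "x a = y a"
  shows "x t = y t"
proof -
  define B where "B = \<bar>t - a\<bar>"
  have "bounded (x ` cball a B \<union> y ` cball a B)"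
    by (intro bounded_Un[THEN iffD2] conjI compact_imp_bounded compact_continuous_image
        ode_sol_continuous_on[OF x] ode_sol_continuous_on[OF y]) auto
  then obtain R where R: "x ` cball a B \<union> y ` cball a B \<subseteq> cball 0 R"
    unfolding bounded_iff by (metis mem_cball_0 subsetI)
  have "compact (A ` cball 0 R)"
    using F unfolding C1_field_def
    by (intro compact_continuous_image) (auto intro: continuous_on_subset)
  then obtain M where M: "\<And>s. s \<in> cball 0 R \<Longrightarrow> norm (A s) \<le> M"
    by (meson bounded_iff compact_imp_bounded image_eqI)
  have lip: "norm (F p - F q) \<le> M * norm (p - q)" if "p \<in> cball 0 R" "q \<in> cball 0 R" for p q
  proof (rule differentiable_bound[OF convex_cball])
    fix s :: "real^'a" assume "s \<in> cball 0 R"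
    show "(F has_derivative (*v) (A s)) (at s within cball 0 R)"
      using F by (auto simp: C1_field_def intro: has_derivative_at_withinI)
    have "onorm ((*v) (A s)) \<le> norm (A s)"
      by (intro onorm_le norm_matrix_vector_mult_le)
    thus "onorm ((*v) (A s)) \<le> M" using M[OF \<open>s \<in> _\<close>] by simp
  qed (use that in auto)
  have "x t - y t = 0"
  proof (rule zero_if_derivative_bounded_by_self)
    show "((\<lambda>t. x t - y t) has_vector_derivative (F (x t) - F (y t))) (at t)" for t
      using x y by (intro has_vector_derivative_diff) (auto simp: ode_sol_def)
    show "norm (F (x s) - F (y s)) \<le> M * norm (x s - y s)" if "\<bar>s - a\<bar> \<le> B" for s
    proof -
      have "s \<in> cball a B" using that by (simp add: dist_real_def abs_minus_commute)
      thus ?thesis using R by (intro lip) blast+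
    qed
  qed (use a in \<open>auto simp: B_def\<close>)
  thus ?thesis by simp
qed

lemma ode_sol_shift: "ode_sol F g \<Longrightarrow> ode_sol F (\<lambda>t. g (t + c))"
  unfolding ode_sol_def
proof
  fix t assume "\<forall>t. (g has_vector_derivative F (g t)) (at t)"
  hence "((g \<circ> (\<lambda>t. t + c)) has_vector_derivative 1 *\<^sub>R F (g (t + c))) (at t)"
    by (intro vector_diff_chain_at) (auto intro!: derivative_eq_intros)
  thus "((\<lambda>t. g (t + c)) has_vector_derivative F (g (t + c))) (at t)" by (simp add: o_def)
qed

section \<open>Solutions of the variational equation\<close>

lemma variational_solution:
  assumes "C1_field F A" "variational F g Y"
  shows "((\<lambda>t. Y t *v v) has_vector_derivative A (g t) *v (Y t *v v)) (at t)"
  using assms has_vector_derivative_matrix_vector_mult[of Y _ t v]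
  by (auto simp: variational_def C1_field_jacobian matrix_vector_mul_assoc)

text \<open>By uniqueness, an explicit solution of the variational equation shows how an arbitrary
  fundamental matrix \<open>Y\<close> acts on its initial vector.\<close>

lemma variational_eq:
  assumes F: "C1_field F A" and g: "ode_sol F g" and Y: "variational F g Y"
    and x: "\<And>t. (x has_vector_derivative A (g t) *v x t) (at t)"
  shows "Y t *v x 0 = x t"
proof (rule linear_ode_unique[where A = "\<lambda>t. A (g t)" and a = 0])
  show "continuous_on UNIV (\<lambda>t. A (g t))"
    using F ode_sol_continuous_on[OF g]
    by (auto simp: C1_field_def intro: continuous_on_compose2)
  show "Y 0 *v x 0 = x 0" using Y by (simp add: variational_def)
qed (use variational_solution[OF F Y] x in auto)

text \<open>The columns of \<open>Y\<close> are the solutions that start at the basis vectors. No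
  existence theorem is invoked; on the torus the solutions are written down explicitly.\<close>

lemma variational_exists:
  fixes F :: "real^'n \<Rightarrow> real^'n"
  assumes F: "C1_field F A"
    and sol: "\<And>v. \<exists>x. x 0 = v \<and> (\<forall>t. (x has_vector_derivative A (g t) *v x t) (at t))"
  shows "\<exists>Y. variational F g Y"
proof -
  obtain X where X0: "\<And>v. X v 0 = v"
    and X: "\<And>v t. (X v has_vector_derivative A (g t) *v X v t) (at t)"
    using sol by metis
  define Y :: "real \<Rightarrow> real^'n^'n" where "Y t = (\<chi> i j. X (axis j 1) t $ i)" for t
  have "Y 0 = mat 1" by (simp add: Y_def X0 mat_def axis_def vec_eq_iff)
  moreover have "(Y has_vector_derivative A (g t) ** Y t) (at t)" for t
    unfolding has_vector_derivative_componentwise_cart[of Y]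
      has_vector_derivative_componentwise_cart[of "\<lambda>t. Y t $ i" for i]
  proof (intro allI)
    fix i j
    show "((\<lambda>t. Y t $ i $ j) has_vector_derivative (A (g t) ** Y t) $ i $ j) (at t)"
      using X[of "axis j 1" t] unfolding has_vector_derivative_componentwise_cart[of "X _"]
      by (auto simp: Y_def matrix_matrix_mult_def matrix_vector_mult_def)
  qed
  ultimately show ?thesis using C1_field_jacobian[OF F] by (auto simp: variational_def)
qed

text \<open>Differentiating \<open>g' = F (g)\<close> once more gives the solution that belongs to
  the trivial multiplier 1.\<close>

lemma field_along_solution:
  assumes F: "C1_field F A" and g: "ode_sol F g"
  shows "((\<lambda>t. F (g t)) has_vector_derivative A (g t) *v F (g t)) (at t)"
  using vector_derivative_diff_chain_within[of g "F (g t)" t UNIV F "(*v) (A (g t))"] F g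
  by (auto simp: C1_field_def ode_sol_def o_def intro: has_derivative_at_withinI)

section \<open>Periodic functions, primitives and time changes\<close>

lemma periodic_int_shift:
  fixes h :: "real \<Rightarrow> 'a"
  assumes per: "\<And>t. h (t + T) = h t"
  shows "h (t + of_int k * T) = h t"
proof -
  have nat: "h (t + of_nat n * T) = h t" for n t
  proof (induction n)
    case (Suc n)
    have "t + of_nat (Suc n) * T = (t + of_nat n * T) + T" by (simp add: algebra_simps)
    thus ?case using per Suc by metis
  qed simp
  show ?thesis
  proof (cases "k \<ge> 0")
    case True
    thus ?thesis using nat[of t "nat k"] by simp
  next
    case False
    thus ?thesis using nat[of "t + of_int k * T" "nat (- k)"] by (simp add: algebra_simps)
  qed
qed

lemma exists_period_representative:
  assumes "(T::real) > 0"
  obtains k :: int and r where "t = r + of_int k * T" "0 \<le> r" "r < T"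
proof
  show "t = (t - of_int \<lfloor>t / T\<rfloor> * T) + of_int \<lfloor>t / T\<rfloor> * T" by simp
  show "0 \<le> t - of_int \<lfloor>t / T\<rfloor> * T"
    using mult_right_mono[OF of_int_floor_le[of "t / T"], of T] assms by simp
  have "t / T < of_int \<lfloor>t / T\<rfloor> + 1" by linarith
  thus "t - of_int \<lfloor>t / T\<rfloor> * T < T" using assms by (simp add: field_simps)
qed

text \<open>All values are already taken on the compact interval \<open>{0..T}\<close>, where
  extrema are attained.\<close>

lemma periodic_positive_bounds:
  fixes h :: "real \<Rightarrow> real"
  assumes T: "T > 0" and per: "\<And>t. h (t + T) = h t" and c: "continuous_on UNIV h"
    and pos: "\<And>t. h t > 0"
  obtains m M where "0 < m" "\<And>t. m \<le> h t" "\<And>t. h t \<le> M"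
proof -
  have c': "continuous_on {0..T} h" using c continuous_on_subset by blast
  obtain x where x: "\<And>t. t \<in> {0..T} \<Longrightarrow> h x \<le> h t"
    using continuous_attains_inf[OF compact_Icc _ c'] T by force
  obtain y where y: "\<And>t. t \<in> {0..T} \<Longrightarrow> h t \<le> h y"
    using continuous_attains_sup[OF compact_Icc _ c'] T by force
  have red: "\<exists>r\<in>{0..T}. h t = h r" for t
    using exists_period_representative[OF T, of t] periodic_int_shift[of h, OF per]
    by (metis atLeastAtMost_iff less_imp_le)
  show ?thesis
    by (rule that[of "h x" "h y"]) (use red x y pos in metis)+
qed

lemma antiderivative_real:
  fixes f :: "real \<Rightarrow> real"
  assumes "continuous_on UNIV f"
  shows "\<exists>G. \<forall>t. (G has_real_derivative f t) (at t)"
proof -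
  \<comment> \<open>For every \<open>x\<close> one of the two intervals is empty or a point, so this
    is the oriented integral from 0 to \<open>x\<close>.\<close>
  define G where "G x = integral {0..x} f - integral {x..0} f" for x
  have int: "f integrable_on {a..b}" for a b
    using assms continuous_on_subset integrable_continuous_real by blast
  have "(G has_real_derivative f t) (at t)" for t
  proof -
    define b where "b = \<bar>t\<bar> + 1"
    have "((\<lambda>x. integral {-b..x} f) has_real_derivative f t) (at t within {-b..b})"
      using assms continuous_on_subset by (intro integral_has_real_derivative) (auto simp: b_def)
    hence 1: "((\<lambda>x. integral {-b..x} f - integral {-b..0} f) has_real_derivative f t) (at t)"
      using at_within_Icc_at[of "-b" t b] by (auto intro!: derivative_eq_intros simp: b_def)
    have eq: "integral {-b..x} f - integral {-b..0} f = G x" if "x \<in> {-b<..<b}" for x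
    proof (cases "x \<ge> 0")
      case True
      show ?thesis using True that
        Henstock_Kurzweil_Integration.integral_combine[OF _ _ int, of "-b" 0 x]
        by (cases "x = 0") (auto simp: G_def)
    next
      case False
      thus ?thesis using that
        Henstock_Kurzweil_Integration.integral_combine[OF _ _ int, of "-b" x 0]
        by (auto simp: G_def)
    qed
    show ?thesis
      by (rule has_field_derivative_transform_within_open[OF 1, where S = "{-b<..<b}"])
         (use eq in \<open>auto simp: b_def\<close>)
  qed
  thus ?thesis by blast
qed

text \<open>Separation of variables: \<open>\<tau>\<close> is the inverse of a primitive
  \<open>G\<close> of \<open>1 / h\<close> that vanishes at \<open>a\<close>. Because
  \<open>h\<close> is at most \<open>M\<close>, \<open>G\<close> grows at least with slope
  \<open>1 / M\<close>; it is therefore onto, and \<open>\<tau>\<close> exists for all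
  times.\<close>

lemma time_change_exists:
  fixes h :: "real \<Rightarrow> real"
  assumes c: "continuous_on UNIV h" and m: "0 < m" "\<And>t. m \<le> h t" and M: "\<And>t. h t \<le> M"
  shows "\<exists>\<tau>. \<tau> 0 = a \<and> (\<forall>s. (\<tau> has_real_derivative h (\<tau> s)) (at s))"
proof -
  have hpos: "h t > 0" for t using m less_le_trans by blast
  have Mpos: "M > 0" using hpos M less_le_trans by blast
  have "continuous_on UNIV (\<lambda>t. 1 / h t)"
    by (intro continuous_intros c) (metis hpos less_irrefl)
  then obtain G0 where G0: "\<And>t. (G0 has_real_derivative 1 / h t) (at t)"
    using antiderivative_real by blast
  define G where "G t = G0 t - G0 a" for t
  have G: "(G has_real_derivative 1 / h t) (at t)" for t
    unfolding G_def using G0[of t] by (auto intro!: derivative_eq_intros)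
  have contG: "continuous_on S G" for S
    using G by (meson DERIV_isCont continuous_at_imp_continuous_on)
  have mono: "G s < G t" if "s < t" for s t
    by (rule DERIV_pos_imp_increasing[OF that]) (meson G hpos zero_less_divide_1_iff)
  have grow: "G t - G s \<ge> (t - s) / M" if "s \<le> t" for s t
  proof -
    have "G s - s / M \<le> G t - t / M"
    proof (rule DERIV_nonneg_imp_nondecreasing[OF that])
      fix x
      have "((\<lambda>t. G t - t / M) has_real_derivative 1 / h x - 1 / M) (at x)"
        using G[of x] Mpos by (auto intro!: derivative_eq_intros)
      moreover have "1 / h x - 1 / M \<ge> 0"
        using hpos[of x] M[of x] Mpos by (simp add: frac_le)
      ultimately show "\<exists>y. ((\<lambda>t. G t - t / M) has_real_derivative y) (at x) \<and> 0 \<le> y" by blast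
    qed
    thus ?thesis by (simp add: diff_divide_distrib)
  qed
  have surj: "\<exists>t. G t = s" for s
  proof -
    have Ga: "G a = 0" by (simp add: G_def)
    \<comment> \<open>With slope at least \<open>1 / M\<close>, a distance of
      \<open>M * \<bar>s\<bar>\<close> from \<open>a\<close> suffices to pass the value
      \<open>s\<close> on either side.\<close>
    define t0 t1 where "t0 = a - M * \<bar>s\<bar>" and "t1 = a + M * \<bar>s\<bar>"
    have le: "t0 \<le> a" "a \<le> t1" using Mpos by (auto simp: t0_def t1_def)
    have "G t0 \<le> s" using grow[OF le(1)] Mpos Ga by (simp add: t0_def)
    moreover have "G t1 \<ge> s" using grow[OF le(2)] Mpos Ga by (simp add: t1_def)
    ultimately show ?thesis using IVT'[of G t0 s t1] contG le by force
  qed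
  have inj: "inj G" by (rule injI) (metis mono linorder_neqE_linordered_idom less_irrefl)
  define \<tau> where "\<tau> = inv G"
  have \<tau>G: "\<tau> (G t) = t" for t by (simp add: \<tau>_def inj)
  have G\<tau>: "G (\<tau> s) = s" for s unfolding \<tau>_def using surj by (metis f_inv_into_f rangeI)
  have cont: "isCont \<tau> s" for s
  proof -
    have "isCont \<tau> (G (\<tau> s))"
      by (rule isCont_inverse_function[where d = 1]) (use \<tau>G G in \<open>auto intro: DERIV_isCont\<close>)
    thus ?thesis by (simp add: G\<tau>)
  qed
  have "(\<tau> has_real_derivative h (\<tau> s)) (at s)" for s
  proof -
    have "(\<tau> has_real_derivative inverse (1 / h (\<tau> s))) (at s)"
      by (rule DERIV_inverse_function[where f = G and a = "s - 1" and b = "s + 1"])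
         (use G G\<tau> cont hpos in \<open>auto simp: less_imp_neq[symmetric]\<close>)
    thus ?thesis by simp
  qed
  moreover have "\<tau> 0 = a" using \<tau>G[of a] by (simp add: G_def)
  ultimately show ?thesis by blast
qed

section \<open>The lifted field\<close>

text \<open>The partial derivatives are named functions, so that the Jacobians below are explicit
  formulas in them.\<close>

definition C1_fun2 :: "(real \<Rightarrow> real \<Rightarrow> real) \<Rightarrow> (real \<Rightarrow> real \<Rightarrow> real) \<Rightarrow> (real \<Rightarrow> real \<Rightarrow> real) \<Rightarrow> bool" where
  "C1_fun2 P Pu Pz \<longleftrightarrow> continuous_on UNIV (\<lambda>v. Pu (fst v) (snd v)) \<and>
     continuous_on UNIV (\<lambda>v. Pz (fst v) (snd v)) \<and>
     (\<forall>a b. ((\<lambda>v. P (fst v) (snd v)) has_derivative (\<lambda>h. Pu a b * fst h + Pz a b * snd h)) (at (a, b)))"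

lemma C1_fun2_has_derivative:
  assumes "C1_fun2 P Pu Pz" "(f has_derivative f') (at x)" "(g has_derivative g') (at x)"
  shows "((\<lambda>x. P (f x) (g x)) has_derivative
           (\<lambda>h. Pu (f x) (g x) * f' h + Pz (f x) (g x) * g' h)) (at x)"
  using has_derivative_compose[OF has_derivative_Pair[OF assms(2,3)],
      of "\<lambda>v. P (fst v) (snd v)" "\<lambda>h. Pu (f x) (g x) * fst h + Pz (f x) (g x) * snd h"] assms(1)
  by (simp add: C1_fun2_def)

lemma C1_fun2_DERIV:
  assumes "C1_fun2 P Pu Pz" "(f has_real_derivative f') (at x)" "(g has_real_derivative g') (at x)"
  shows "((\<lambda>x. P (f x) (g x)) has_real_derivative Pu (f x) (g x) * f' + Pz (f x) (g x) * g') (at x)"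
  using C1_fun2_has_derivative[OF assms(1) assms(2,3)[unfolded has_field_derivative_def]]
  unfolding has_field_derivative_def
  by (rule has_derivative_eq_rhs) (auto simp: algebra_simps)

lemma continuous_on_compose_fun2:
  assumes "continuous_on UNIV (\<lambda>v. f (fst v) (snd v))" "continuous_on S g" "continuous_on S h"
  shows "continuous_on S (\<lambda>x. f (g x) (h x))"
  using continuous_on_compose2[OF assms(1) continuous_on_Pair[OF assms(2,3)]] by simp

lemma C1_fun2_continuous:
  assumes "C1_fun2 P Pu Pz" "continuous_on S g" "continuous_on S h"
  shows "continuous_on S (\<lambda>x. P (g x) (h x))" "continuous_on S (\<lambda>x. Pu (g x) (h x))"
    "continuous_on S (\<lambda>x. Pz (g x) (h x))"
proof -
  have "continuous_on UNIV (\<lambda>v. P (fst v) (snd v))"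
    using assms(1) unfolding C1_fun2_def
    by (auto intro!: continuous_at_imp_continuous_on has_derivative_continuous)
  thus "continuous_on S (\<lambda>x. P (g x) (h x))" "continuous_on S (\<lambda>x. Pu (g x) (h x))"
    "continuous_on S (\<lambda>x. Pz (g x) (h x))"
    using assms by (auto simp: C1_fun2_def intro: continuous_on_compose_fun2[where f = P]
        continuous_on_compose_fun2[where f = Pu] continuous_on_compose_fun2[where f = Pz])
qed

definition planar_jac ::
  "(real \<Rightarrow> real \<Rightarrow> real) \<Rightarrow> (real \<Rightarrow> real \<Rightarrow> real) \<Rightarrow> (real \<Rightarrow> real \<Rightarrow> real) \<Rightarrow> (real \<Rightarrow> real \<Rightarrow> real)
    \<Rightarrow> real^2 \<Rightarrow> real^2^2" where
  "planar_jac Pu Pz Qu Qz v = vector [vector [Pu (v$1) (v$2), Pz (v$1) (v$2)],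
     vector [Qu (v$1) (v$2), Qz (v$1) (v$2)]]"

lemma planar_jac_mult [simp]:
  "(planar_jac Pu Pz Qu Qz v *v h) $ 1 = Pu (v$1) (v$2) * h$1 + Pz (v$1) (v$2) * h$2"
  "(planar_jac Pu Pz Qu Qz v *v h) $ 2 = Qu (v$1) (v$2) * h$1 + Qz (v$1) (v$2) * h$2"
  by (simp_all add: planar_jac_def matrix_vector_mult_def sum_2)

lemma field2_nth [simp]:
  "field2 P Q v $ 1 = P (v$1) (v$2)" "field2 P Q v $ 2 = Q (v$1) (v$2)"
  by (simp_all add: field2_def)

lemma field3_nth [simp]:
  "field3 P Q R v $ 1 = P (v$1) (v$2) (v$3)" "field3 P Q R v $ 2 = Q (v$1) (v$2) (v$3)"
  "field3 P Q R v $ 3 = R (v$1) (v$2) (v$3)"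
  by (simp_all add: field3_def)

lemma continuous_on_componentwise_cart:
  fixes f :: "'a::topological_space \<Rightarrow> 'b::topological_space^'n"
  assumes "\<And>i. continuous_on S (\<lambda>x. f x $ i)"
  shows "continuous_on S f"
  using continuous_on_vec_lambda[of S "\<lambda>i x. f x $ i"] assms by simp

lemma has_derivative_nth [derivative_intros]:
  "((\<lambda>v. v $ i) has_derivative (\<lambda>h. h $ i)) F"
  by (rule bounded_linear.has_derivative[OF bounded_linear_vec_nth has_derivative_ident])

lemma C1_field_planar:
  assumes "C1_fun2 P Pu Pz" "C1_fun2 Q Qu Qz"
  shows "C1_field (field2 P Q) (planar_jac Pu Pz Qu Qz)"
  unfolding C1_field_def
proof (intro conjI allI)
  have "continuous_on UNIV (\<lambda>v. planar_jac Pu Pz Qu Qz v $ i $ j)" for i j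
    using exhaust_2[of i] exhaust_2[of j]
    by (elim disjE; simp add: planar_jac_def;
        intro C1_fun2_continuous[OF assms(1)] C1_fun2_continuous[OF assms(2)] continuous_intros)
  thus "continuous_on UNIV (planar_jac Pu Pz Qu Qz)"
    by (intro continuous_on_componentwise_cart)
  fix x
  show "(field2 P Q has_derivative (*v) (planar_jac Pu Pz Qu Qz x)) (at x)"
    unfolding has_derivative_componentwise_cart[of "field2 P Q"] forall_2
    by (auto intro!: C1_fun2_has_derivative[OF assms(1)] C1_fun2_has_derivative[OF assms(2)]
        has_derivative_nth)
qed

definition lifted_field :: "(real \<Rightarrow> real \<Rightarrow> real) \<Rightarrow> (real \<Rightarrow> real \<Rightarrow> real) \<Rightarrow> real \<Rightarrow> real^3 \<Rightarrow> real^3" where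
  "lifted_field P Q K = field3 (\<lambda>x y z. - y + x * P (x^2 + y^2 - K) z)
     (\<lambda>x y z. x + y * P (x^2 + y^2 - K) z) (\<lambda>x y z. 2 * (x^2 + y^2) * Q (x^2 + y^2 - K) z)"

definition lifted_jac ::
  "(real \<Rightarrow> real \<Rightarrow> real) \<Rightarrow> (real \<Rightarrow> real \<Rightarrow> real) \<Rightarrow> (real \<Rightarrow> real \<Rightarrow> real) \<Rightarrow> (real \<Rightarrow> real \<Rightarrow> real)
    \<Rightarrow> (real \<Rightarrow> real \<Rightarrow> real) \<Rightarrow> (real \<Rightarrow> real \<Rightarrow> real) \<Rightarrow> real \<Rightarrow> real^3 \<Rightarrow> real^3^3" where
  "lifted_jac P Pu Pz Q Qu Qz K v =
     (let x = v$1; y = v$2; z = v$3; w = x^2 + y^2; u = w - K in vector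
       [vector [P u z + 2 * x^2 * Pu u z, - 1 + 2 * x * y * Pu u z, x * Pz u z],
        vector [1 + 2 * x * y * Pu u z, P u z + 2 * y^2 * Pu u z, y * Pz u z],
        vector [4 * x * (Q u z + w * Qu u z), 4 * y * (Q u z + w * Qu u z), 2 * w * Qz u z]])"

text \<open>The combination \<open>2 * (v$1 * h$1 + v$2 * h$2)\<close> is the variation of
  \<open>u\<close> in direction \<open>h\<close>. Keeping \<open>u\<close> as a separate variable
  allows it to be replaced by the planar cycle coordinate later.\<close>

lemma lifted_jac_mult:
  fixes v :: "real^3"
  assumes "u = (v$1)^2 + (v$2)^2 - K"
  shows "(lifted_jac P Pu Pz Q Qu Qz K v *v h) $ 1 =
      - h$2 + h$1 * P u (v$3) + v$1 * (Pu u (v$3) * (2 * (v$1 * h$1 + v$2 * h$2)) + Pz u (v$3) * h$3)"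
    "(lifted_jac P Pu Pz Q Qu Qz K v *v h) $ 2 =
      h$1 + h$2 * P u (v$3) + v$2 * (Pu u (v$3) * (2 * (v$1 * h$1 + v$2 * h$2)) + Pz u (v$3) * h$3)"
    "(lifted_jac P Pu Pz Q Qu Qz K v *v h) $ 3 =
      2 * (2 * (v$1 * h$1 + v$2 * h$2)) * Q u (v$3) +
      2 * (u + K) * (Qu u (v$3) * (2 * (v$1 * h$1 + v$2 * h$2)) + Qz u (v$3) * h$3)"
  by (simp_all add: assms lifted_jac_def Let_def matrix_vector_mult_def sum_3 power2_eq_square
      algebra_simps)

lemma lifted_field_nth:
  assumes "u = (v$1)^2 + (v$2)^2 - K"
  shows "lifted_field P Q K v $ 1 = - v$2 + v$1 * P u (v$3)"
    "lifted_field P Q K v $ 2 = v$1 + v$2 * P u (v$3)"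
    "lifted_field P Q K v $ 3 = 2 * (u + K) * Q u (v$3)"
  by (simp_all add: assms lifted_field_def)

lemma C1_field_lifted:
  assumes "C1_fun2 P Pu Pz" "C1_fun2 Q Qu Qz"
  shows "C1_field (lifted_field P Q K) (lifted_jac P Pu Pz Q Qu Qz K)"
  unfolding C1_field_def
proof (intro conjI allI)
  have "continuous_on UNIV (\<lambda>v. lifted_jac P Pu Pz Q Qu Qz K v $ i $ j)" for i j
    using exhaust_3[of i] exhaust_3[of j]
    by (elim disjE; simp add: lifted_jac_def Let_def;
        intro C1_fun2_continuous[OF assms(1)] C1_fun2_continuous[OF assms(2)] continuous_intros)
  thus "continuous_on UNIV (lifted_jac P Pu Pz Q Qu Qz K)"
    by (intro continuous_on_componentwise_cart)
  fix v
  show "(lifted_field P Q K has_derivative (*v) (lifted_jac P Pu Pz Q Qu Qz K v)) (at v)"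
    unfolding has_derivative_componentwise_cart[of "lifted_field P Q K"] forall_3
    by (auto simp: lifted_field_def lifted_jac_mult[OF refl]
        intro!: derivative_eq_intros C1_fun2_has_derivative[OF assms(1)]
          C1_fun2_has_derivative[OF assms(2)])
      (simp_all add: fun_eq_iff algebra_simps power2_eq_square)
qed

text \<open>
  \<open>(n1, n2)\<close> is a solution of the planar variational equation along the cycle \<open>(u, z)\<close>. The equation
  for \<open>k\<close> is what makes \<open>(n1, n2) + k \<rho> (P, Q)\<close> solve the variational equation of the time-changed
  field \<open>\<rho> (P, Q)\<close>, and \<open>k (t + T) = \<mu> k t\<close> keeps the multiplier.
\<close>
locale planar_cycle_lift =
  fixes P Q Pu Pz Qu Qz :: "real \<Rightarrow> real \<Rightarrow> real" and K T \<mu> :: real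
    and u z n1 n2 k :: "real \<Rightarrow> real"
  assumes C1_P: "C1_fun2 P Pu Pz" and C1_Q: "C1_fun2 Q Qu Qz"
    and T_pos: "T > 0"
    and u_deriv: "(u has_real_derivative P (u t) (z t)) (at t)"
    and z_deriv: "(z has_real_derivative Q (u t) (z t)) (at t)"
    and u_per: "u (t + T) = u t" and z_per: "z (t + T) = z t"
    and cycle_inj: "u s = u t \<Longrightarrow> z s = z t \<Longrightarrow> \<exists>j::int. s = t + of_int j * T"
    and u_gt: "u t + K > 0"
    and n1_deriv: "(n1 has_real_derivative Pu (u t) (z t) * n1 t + Pz (u t) (z t) * n2 t) (at t)"
    and n2_deriv: "(n2 has_real_derivative Qu (u t) (z t) * n1 t + Qz (u t) (z t) * n2 t) (at t)"
    and n1_per: "n1 (t + T) = \<mu> * n1 t" and n2_per: "n2 (t + T) = \<mu> * n2 t"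
    and k_deriv: "(k has_real_derivative 2 * n1 t / (2 * (u t + K))^2) (at t)"
    and k_per: "k (t + T) = \<mu> * k t"
    and \<mu>_nz: "\<mu> \<noteq> 0" and \<mu>_hyp: "\<bar>\<mu>\<bar> \<noteq> 1"
    and transverse: "P (u t) (z t) * n2 t - Q (u t) (z t) * n1 t \<noteq> 0"
begin

definition "\<rho> t = 2 * (u t + K)"
definition "r t = sqrt (u t + K)"
definition "p t = P (u t) (z t)"
definition "q t = Q (u t) (z t)"
text \<open>A variation of \<open>u\<close> by \<open>\<rho> * \<eta>\<close> changes the radius by
  \<open>\<rho> * \<eta> / (2 * r)\<close>, which is \<open>r * \<eta>\<close> since
  \<open>\<rho>\<close> is twice the square of \<open>r\<close>; hence the division by
  \<open>\<rho>\<close>.\<close>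

definition "\<eta> t = n1 t / \<rho> t + k t * p t"
definition "\<delta> t = n2 t + k t * \<rho> t * q t"

text \<open>The formula serves both for points in the half-plane at angle \<open>\<phi>\<close> and
  for vectors tangent to that half-plane.\<close>

definition meridian :: "real \<Rightarrow> real \<Rightarrow> real \<Rightarrow> real^3" where
  "meridian \<phi> a b = vector [a * cos \<phi>, a * sin \<phi>, b]"

text \<open>
  Along the torus \<open>E\<close>, the variational equation is solved by the rotation field \<open>X\<close>, by the lift \<open>Z\<close> of
  \<open>\<rho> (P, Q)\<close>, and by the lift \<open>\<Xi>\<close> of \<open>(n1, n2) + k \<rho> (P, Q)\<close>, whose first component is \<open>\<rho> \<eta>\<close>
  and whose second component is \<open>\<delta>\<close>.
\<close>
definition "E \<phi> t = meridian \<phi> (r t) (z t)"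
definition X :: "real \<Rightarrow> real \<Rightarrow> real^3" where
  "X \<phi> t = vector [- r t * sin \<phi>, r t * cos \<phi>, 0]"
definition "Z \<phi> t = meridian \<phi> (r t * p t) (\<rho> t * q t)"
definition "\<Xi> \<phi> t = meridian \<phi> (r t * \<eta> t) (\<delta> t)"

abbreviation "F \<equiv> lifted_field P Q K"
abbreviation "A \<equiv> lifted_jac P Pu Pz Q Qu Qz K"

lemma meridian_nth [simp]: "meridian \<phi> a b $ 1 = a * cos \<phi>" "meridian \<phi> a b $ 2 = a * sin \<phi>"
  "meridian \<phi> a b $ 3 = b"
  by (simp_all add: meridian_def)

lemma X_nth [simp]: "X \<phi> t $ 1 = - r t * sin \<phi>" "X \<phi> t $ 2 = r t * cos \<phi>" "X \<phi> t $ 3 = 0"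
  by (simp_all add: X_def)

lemma \<rho>_pos: "\<rho> t > 0" and r_pos: "r t > 0" and r_sq: "(r t)^2 = u t + K"
  using u_gt[of t] by (simp_all add: \<rho>_def r_def)

lemma E_radius: "(E \<phi> t $ 1)^2 + (E \<phi> t $ 2)^2 = u t + K"
proof -
  have "(E \<phi> t $ 1)^2 + (E \<phi> t $ 2)^2 = (r t)^2 * ((cos \<phi>)^2 + (sin \<phi>)^2)"
    unfolding E_def meridian_nth power_mult_distrib distrib_left ..
  thus ?thesis by (simp add: r_sq)
qed

lemma r_deriv: "(r has_real_derivative r t * p t / \<rho> t) (at t)"
proof -
  have "(r has_real_derivative inverse (sqrt (u t + K)) / 2 * p t) (at t)"
    unfolding r_def[abs_def] p_def
    by (rule DERIV_chain2[where f = sqrt and g = "\<lambda>t. u t + K", OF DERIV_real_sqrt[OF u_gt]]) (auto intro!: derivative_eq_intros u_deriv)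
  moreover have "inverse (sqrt (u t + K)) / 2 = r t / \<rho> t"
  proof -
    have "sqrt (u t + K) = r t" "\<rho> t = 2 * (r t)^2" by (simp_all add: r_def \<rho>_def r_sq[unfolded r_def])
    thus ?thesis using r_pos[of t] by (simp add: field_simps power2_eq_square)
  qed
  ultimately show ?thesis by (simp add: mult.commute)
qed

lemma p_deriv: "(p has_real_derivative Pu (u t) (z t) * p t + Pz (u t) (z t) * q t) (at t)"
  using C1_fun2_DERIV[OF C1_P u_deriv z_deriv, of t] by (simp add: p_def[abs_def] q_def)

lemma q_deriv: "(q has_real_derivative Qu (u t) (z t) * p t + Qz (u t) (z t) * q t) (at t)"
  using C1_fun2_DERIV[OF C1_Q u_deriv z_deriv, of t] by (simp add: q_def[abs_def] p_def)

lemma \<rho>_deriv: "(\<rho> has_real_derivative 2 * p t) (at t)"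
  unfolding \<rho>_def[abs_def] p_def by (auto intro!: derivative_eq_intros u_deriv)

text \<open>The term of the quotient rule that comes from the derivative \<open>2 * p\<close> of
  \<open>\<rho>\<close> cancels against the contribution of \<open>k'\<close>. This is the purpose
  of the equation for \<open>k\<close>.\<close>

lemma \<eta>_deriv:
  "(\<eta> has_real_derivative (Pu (u t) (z t) * (\<rho> t * \<eta> t) + Pz (u t) (z t) * \<delta> t) / \<rho> t) (at t)"
proof -
  have "(\<eta> has_real_derivative
      ((Pu (u t) (z t) * n1 t + Pz (u t) (z t) * n2 t) * \<rho> t - n1 t * (2 * p t)) / (\<rho> t * \<rho> t) +
      (2 * n1 t / (\<rho> t)^2 * p t + (Pu (u t) (z t) * p t + Pz (u t) (z t) * q t) * k t)) (at t)"
    unfolding \<eta>_def[abs_def] using \<rho>_pos[of t] k_deriv[of t]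
    by (intro DERIV_add DERIV_mult DERIV_divide n1_deriv p_deriv \<rho>_deriv) (auto simp: \<rho>_def)
  also have "((Pu (u t) (z t) * n1 t + Pz (u t) (z t) * n2 t) * \<rho> t - n1 t * (2 * p t)) / (\<rho> t * \<rho> t) +
      (2 * n1 t / (\<rho> t)^2 * p t + (Pu (u t) (z t) * p t + Pz (u t) (z t) * q t) * k t)
    = (Pu (u t) (z t) * (\<rho> t * \<eta> t) + Pz (u t) (z t) * \<delta> t) / \<rho> t"
    using \<rho>_pos[of t] by (simp add: \<eta>_def \<delta>_def field_simps power2_eq_square)
  finally show ?thesis .
qed

text \<open>Here \<open>k'\<close> and the derivative of \<open>\<rho>\<close> combine to
  \<open>2 * \<eta> * q\<close>, the effect of varying the factor \<open>\<rho>\<close> in the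
  equation for \<open>z\<close>.\<close>

lemma \<delta>_deriv:
  "(\<delta> has_real_derivative Qu (u t) (z t) * (\<rho> t * \<eta> t) + Qz (u t) (z t) * \<delta> t + 2 * \<eta> t * q t) (at t)"
proof -
  have "(\<delta> has_real_derivative Qu (u t) (z t) * n1 t + Qz (u t) (z t) * n2 t +
      ((2 * n1 t / (\<rho> t)^2 * \<rho> t + 2 * p t * k t) * q t +
       (Qu (u t) (z t) * p t + Qz (u t) (z t) * q t) * (k t * \<rho> t))) (at t)"
    unfolding \<delta>_def[abs_def] using k_deriv[of t]
    by (intro DERIV_add DERIV_mult n2_deriv q_deriv \<rho>_deriv) (auto simp: \<rho>_def)
  also have "Qu (u t) (z t) * n1 t + Qz (u t) (z t) * n2 t +
      ((2 * n1 t / (\<rho> t)^2 * \<rho> t + 2 * p t * k t) * q t +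
       (Qu (u t) (z t) * p t + Qz (u t) (z t) * q t) * (k t * \<rho> t))
    = Qu (u t) (z t) * (\<rho> t * \<eta> t) + Qz (u t) (z t) * \<delta> t + 2 * \<eta> t * q t"
    using \<rho>_pos[of t] by (simp add: \<eta>_def \<delta>_def field_simps power2_eq_square)
  finally show ?thesis .
qed

section \<open>Solutions of the lifted equation and its linearization, with \<open>\<tau>\<close>
  the planar time as a function of the lifted time\<close>

context
  fixes \<phi> :: real and \<tau> :: "real \<Rightarrow> real"
  assumes \<tau>: "(\<tau> has_real_derivative \<rho> (\<tau> s)) (at s)"
begin

lemma chain_\<tau>: "(f has_real_derivative d) (at (\<tau> s)) \<Longrightarrow>
    ((\<lambda>s. f (\<tau> s)) has_real_derivative d * \<rho> (\<tau> s)) (at s)"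
  by (rule DERIV_chain2[OF _ \<tau>])

lemma r_\<tau>: "((\<lambda>s. r (\<tau> s)) has_real_derivative r (\<tau> s) * p (\<tau> s)) (at s)"
  using chain_\<tau>[OF r_deriv, of s] \<rho>_pos[of "\<tau> s"] by simp

lemma ode_sol_E: "ode_sol F (\<lambda>s. E (\<phi> + s) (\<tau> s))"
  unfolding ode_sol_componentwise
proof
  fix s
  have e: "u (\<tau> s) = (E (\<phi> + s) (\<tau> s) $ 1)^2 + (E (\<phi> + s) (\<tau> s) $ 2)^2 - K" by (simp add: E_radius)
  show "\<forall>i. ((\<lambda>s. E (\<phi> + s) (\<tau> s) $ i) has_real_derivative F (E (\<phi> + s) (\<tau> s)) $ i) (at s)"
    unfolding forall_3 lifted_field_nth[OF e]
    using chain_\<tau>[OF z_deriv, of s]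
    by (auto simp: E_def p_def \<rho>_def algebra_simps intro!: derivative_eq_intros r_\<tau>)
qed

text \<open>\<open>X\<close> generates the rotations about the third axis, which are symmetries of
  the lifted field; the equation is verified in coordinates.\<close>

lemma variational_X:
  "((\<lambda>s. X (\<phi> + s) (\<tau> s)) has_vector_derivative A (E (\<phi> + s) (\<tau> s)) *v X (\<phi> + s) (\<tau> s)) (at s)"
proof -
  have e: "u (\<tau> s) = (E (\<phi> + s) (\<tau> s) $ 1)^2 + (E (\<phi> + s) (\<tau> s) $ 2)^2 - K" by (simp add: E_radius)
  show ?thesis
    unfolding has_vector_derivative_componentwise_cart[of "\<lambda>s. X (\<phi> + s) (\<tau> s)"] forall_3
      has_real_derivative_iff_has_vector_derivative[symmetric] lifted_jac_mult[OF e]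
    by (auto simp: E_def p_def algebra_simps intro!: derivative_eq_intros r_\<tau>)
qed

text \<open>By rotational symmetry the linearization acts within the meridian half-planes as the
  planar linearization of \<open>\<rho> (P, Q)\<close>, where \<open>\<rho> * a\<close> is the
  variation of \<open>u\<close> and \<open>b\<close> that of \<open>z\<close>. The hypotheses state
  it in planar time, so the chain rule along \<open>\<tau>\<close> supplies a factor
  \<open>\<rho>\<close>.\<close>

lemma variational_meridian:
  assumes a: "\<And>t. (a has_real_derivative
      (Pu (u t) (z t) * (\<rho> t * a t) + Pz (u t) (z t) * b t) / \<rho> t) (at t)"
    and b: "\<And>t. (b has_real_derivative
      Qu (u t) (z t) * (\<rho> t * a t) + Qz (u t) (z t) * b t + 2 * a t * q t) (at t)"
  shows "((\<lambda>s. meridian (\<phi> + s) (r (\<tau> s) * a (\<tau> s)) (b (\<tau> s))) has_vector_derivative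
    A (E (\<phi> + s) (\<tau> s)) *v meridian (\<phi> + s) (r (\<tau> s) * a (\<tau> s)) (b (\<tau> s))) (at s)"
proof -
  have e: "u (\<tau> s) = (E (\<phi> + s) (\<tau> s) $ 1)^2 + (E (\<phi> + s) (\<tau> s) $ 2)^2 - K" by (simp add: E_radius)
  have a': "((\<lambda>s. a (\<tau> s)) has_real_derivative
      Pu (u (\<tau> s)) (z (\<tau> s)) * (\<rho> (\<tau> s) * a (\<tau> s)) + Pz (u (\<tau> s)) (z (\<tau> s)) * b (\<tau> s)) (at s)"
    using chain_\<tau>[OF a, of s] \<rho>_pos[of "\<tau> s"] by simp
  have m: "2 * (E (\<phi> + s) (\<tau> s) $ 1 * meridian (\<phi> + s) (r (\<tau> s) * a (\<tau> s)) (b (\<tau> s)) $ 1 +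
      E (\<phi> + s) (\<tau> s) $ 2 * meridian (\<phi> + s) (r (\<tau> s) * a (\<tau> s)) (b (\<tau> s)) $ 2) =
      \<rho> (\<tau> s) * a (\<tau> s)"
  proof -
    have "2 * (E (\<phi> + s) (\<tau> s) $ 1 * meridian (\<phi> + s) (r (\<tau> s) * a (\<tau> s)) (b (\<tau> s)) $ 1 +
      E (\<phi> + s) (\<tau> s) $ 2 * meridian (\<phi> + s) (r (\<tau> s) * a (\<tau> s)) (b (\<tau> s)) $ 2) =
      2 * ((E (\<phi> + s) (\<tau> s) $ 1)^2 + (E (\<phi> + s) (\<tau> s) $ 2)^2) * a (\<tau> s)"
      by (simp add: E_def power2_eq_square algebra_simps)
    thus ?thesis by (simp only: E_radius \<rho>_def)
  qed
  show ?thesis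
    unfolding has_vector_derivative_componentwise_cart[of
        "\<lambda>s. meridian (\<phi> + s) (r (\<tau> s) * a (\<tau> s)) (b (\<tau> s))"] forall_3
      has_real_derivative_iff_has_vector_derivative[symmetric] lifted_jac_mult[OF e] m
    using chain_\<tau>[OF b, of s]
    by (auto simp: E_def p_def q_def \<rho>_def algebra_simps intro!: derivative_eq_intros r_\<tau> a')
qed

lemma variational_\<Xi>:
  "((\<lambda>s. \<Xi> (\<phi> + s) (\<tau> s)) has_vector_derivative A (E (\<phi> + s) (\<tau> s)) *v \<Xi> (\<phi> + s) (\<tau> s)) (at s)"
  unfolding \<Xi>_def by (rule variational_meridian[OF \<eta>_deriv \<delta>_deriv])

lemma variational_Z:
  "((\<lambda>s. Z (\<phi> + s) (\<tau> s)) has_vector_derivative A (E (\<phi> + s) (\<tau> s)) *v Z (\<phi> + s) (\<tau> s)) (at s)"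
proof -
  have "(p has_real_derivative
      (Pu (u t) (z t) * (\<rho> t * p t) + Pz (u t) (z t) * (\<rho> t * q t)) / \<rho> t) (at t)" for t
  proof -
    have "(Pu (u t) (z t) * (\<rho> t * p t) + Pz (u t) (z t) * (\<rho> t * q t)) / \<rho> t =
        Pu (u t) (z t) * p t + Pz (u t) (z t) * q t"
      using \<rho>_pos[of t] by (simp add: field_simps)
    thus ?thesis by (simp only: p_deriv)
  qed
  moreover have "((\<lambda>t. \<rho> t * q t) has_real_derivative
      Qu (u t) (z t) * (\<rho> t * p t) + Qz (u t) (z t) * (\<rho> t * q t) + 2 * p t * q t) (at t)" for t
    using DERIV_mult[OF \<rho>_deriv[of t] q_deriv[of t]] by (simp add: algebra_simps)
  ultimately show ?thesis
    unfolding Z_def by (rule variational_meridian)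
qed

end

end

section \<open>Normal hyperbolicity of the torus\<close>

lemma multiplier_int_shift:
  fixes h :: "real \<Rightarrow> real"
  assumes "\<And>t. h (t + T) = \<mu> * h t" "\<mu> \<noteq> 0"
  shows "h (t + of_int j * T) = \<mu> powi j * h t"
proof (induction j rule: int_induct[where k = 0])
  case (step1 i)
  have "t + of_int (i + 1) * T = (t + of_int i * T) + T" by (simp add: algebra_simps)
  hence "h (t + of_int (i + 1) * T) = \<mu> * h (t + of_int i * T)" using assms(1) by metis
  thus ?case using assms(2) step1 by (simp add: power_int_add)
next
  case (step2 i)
  have "t + of_int i * T = (t + of_int (i - 1) * T) + T" by (simp add: algebra_simps)
  hence "\<mu> powi i * h t = \<mu> * h (t + of_int (i - 1) * T)" using assms(1) step2 by metis
  thus ?case using assms(2) by (simp add: power_int_diff field_simps)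
qed simp

lemma vec3_eq_iff: "v = w \<longleftrightarrow> v$1 = w$1 \<and> v$2 = w$2 \<and> v$3 = (w$3 :: real)" for v w :: "real^3"
  by (simp add: vec_eq_iff forall_3)

lemma angle_shift: "cos (\<phi> + 2 * pi * of_int i) = cos \<phi>" "sin (\<phi> + 2 * pi * of_int i) = sin \<phi>"
  using sin_cos_eq_iff[of "\<phi> + 2 * pi * of_int i" \<phi>] by auto

lemma norm_vec3: "(norm (v :: real^3))\<^sup>2 = (v$1)^2 + (v$2)^2 + (v$3)^2"
  unfolding power2_norm_eq_inner by (simp add: inner_vec_def sum_3 power2_eq_square)

context planar_cycle_lift
begin

lemma data_continuous [simp]: "continuous_on S u" "continuous_on S z" "continuous_on S p" "continuous_on S q"
  "continuous_on S r" "continuous_on S \<rho>" "continuous_on S \<eta>" "continuous_on S \<delta>"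
  by (auto intro!: continuous_at_imp_continuous_on intro: DERIV_isCont u_deriv z_deriv p_deriv
      q_deriv r_deriv \<rho>_deriv \<eta>_deriv \<delta>_deriv)

lemma data_shift [simp]: "r (t + T) = r t" "\<rho> (t + T) = \<rho> t" "p (t + T) = p t" "q (t + T) = q t"
  "\<eta> (t + T) = \<mu> * \<eta> t" "\<delta> (t + T) = \<mu> * \<delta> t"
  by (simp_all add: r_def \<rho>_def p_def q_def \<eta>_def \<delta>_def u_per z_per n1_per n2_per k_per
      distrib_left mult.assoc)

lemma data_int_shift [simp]: "r (t + of_int j * T) = r t" "\<rho> (t + of_int j * T) = \<rho> t"
  "p (t + of_int j * T) = p t" "q (t + of_int j * T) = q t" "z (t + of_int j * T) = z t"
  using periodic_int_shift[of r T] periodic_int_shift[of \<rho> T] periodic_int_shift[of p T]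
    periodic_int_shift[of q T] periodic_int_shift[of z T] z_per by simp_all

lemma frame_shift:
  "E (\<phi> + 2 * pi * of_int i) (t + of_int j * T) = E \<phi> t"
  "X (\<phi> + 2 * pi * of_int i) (t + of_int j * T) = X \<phi> t"
  "Z (\<phi> + 2 * pi * of_int i) (t + of_int j * T) = Z \<phi> t"
  "\<Xi> (\<phi> + 2 * pi * of_int i) (t + of_int j * T) = (\<mu> powi j) *\<^sub>R \<Xi> \<phi> t"
  using multiplier_int_shift[of \<eta> T \<mu> t j] multiplier_int_shift[of \<delta> T \<mu> t j] \<mu>_nz
  by (simp_all add: vec3_eq_iff E_def Z_def \<Xi>_def angle_shift)

text \<open>The distance from the axis and the height determine the point of the planar cycle, hence
  \<open>t\<close> modulo \<open>T\<close>; as the radius is positive, the angle is determined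
  modulo a full turn.\<close>

lemma E_eq_iff:
  "E \<phi> t = E \<phi>' t' \<longleftrightarrow> (\<exists>i j. \<phi> = \<phi>' + 2 * pi * of_int i \<and> t = t' + of_int j * T)" (is "?L \<longleftrightarrow> ?R")
proof
  assume L: ?L
  have u: "u t = u t'" using E_radius[of \<phi> t] E_radius[of \<phi>' t'] L by simp
  hence r: "r t = r t'" by (simp add: r_def)
  have z: "z t = z t'" using arg_cong[OF L, of "\<lambda>v. v $ 3"] by (simp add: E_def)
  have "cos \<phi> = cos \<phi>'" "sin \<phi> = sin \<phi>'"
    using arg_cong[OF L, of "\<lambda>v. v $ 1"] arg_cong[OF L, of "\<lambda>v. v $ 2"] r r_pos[of t']
    by (simp_all add: E_def)
  thus ?R using sin_cos_eq_iff[of \<phi> \<phi>'] cycle_inj[OF u z] by auto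
qed (use frame_shift(1) in auto)

text \<open>In tangential, radial and vertical coordinates \<open>X\<close> spans the first axis and
  \<open>Z\<close>, \<open>\<Xi>\<close> lie in the plane of the other two. What remains is a 2 by 2
  system with determinant \<open>D\<close> up to the factor \<open>r t\<close>.\<close>

lemma frame_decomposition: "\<exists>\<alpha> \<beta> \<kappa>. w = \<alpha> *\<^sub>R X \<phi> t + \<beta> *\<^sub>R Z \<phi> t + \<kappa> *\<^sub>R \<Xi> \<phi> t"
  and frame_independent:
    "\<alpha> *\<^sub>R X \<phi> t + \<beta> *\<^sub>R Z \<phi> t + \<kappa> *\<^sub>R \<Xi> \<phi> t = 0 \<Longrightarrow> \<alpha> = 0 \<and> \<beta> = 0 \<and> \<kappa> = 0"
proof -
  define c s where "c = cos \<phi>" and "s = sin \<phi>"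
  have cs: "c * c + s * s = 1"
    using sin_cos_squared_add[of \<phi>] by (simp add: c_def s_def power2_eq_square)
  define D where "D = p t * \<delta> t - \<eta> t * (\<rho> t * q t)"
  \<comment> \<open>Adding a multiple of the planar field to the second vector leaves the
    determinant unchanged, so \<open>D\<close> is the quantity in \<open>transverse\<close>.\<close>
  have "D = p t * n2 t - q t * n1 t"
    using \<rho>_pos[of t] by (simp add: D_def \<eta>_def \<delta>_def field_simps)
  hence D: "D \<noteq> 0" using transverse[of t] by (simp add: p_def q_def)
  have r0: "r t \<noteq> 0" using r_pos[of t] by simp
  define f where "f w = (- s * w$1 + c * w$2, c * w$1 + s * w$2, w$3)" for w :: "real^3"
  have f_inj: "w = w'" if "f w = f w'" for w w'
  proof -
    have "w$1 = c * (c * w$1 + s * w$2) - s * (- s * w$1 + c * w$2)"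
      "w$2 = s * (c * w$1 + s * w$2) + c * (- s * w$1 + c * w$2)" for w :: "real^3"
      using cs by algebra+
    thus ?thesis using that unfolding f_def vec3_eq_iff prod.inject by metis
  qed
  have f_frame: "f (\<alpha> *\<^sub>R X \<phi> t + \<beta> *\<^sub>R Z \<phi> t + \<kappa> *\<^sub>R \<Xi> \<phi> t) =
      (r t * \<alpha>, r t * (\<beta> * p t + \<kappa> * \<eta> t), \<beta> * (\<rho> t * q t) + \<kappa> * \<delta> t)" for \<alpha> \<beta> \<kappa>
    using cs unfolding f_def prod.inject
    by (simp add: Z_def \<Xi>_def c_def[symmetric] s_def[symmetric]) algebra
  show "\<exists>\<alpha> \<beta> \<kappa>. w = \<alpha> *\<^sub>R X \<phi> t + \<beta> *\<^sub>R Z \<phi> t + \<kappa> *\<^sub>R \<Xi> \<phi> t"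
  proof -
    obtain a b d where w: "f w = (a, b, d)" by (cases "f w") auto
    define b' where "b' = b / r t"
    \<comment> \<open>Cramer's rule.\<close>
    define \<beta> \<kappa> where "\<beta> = (b' * \<delta> t - d * \<eta> t) / D"
      and "\<kappa> = (d * p t - b' * (\<rho> t * q t)) / D"
    have "\<beta> * p t + \<kappa> * \<eta> t = b' * D / D"
      unfolding \<beta>_def \<kappa>_def by (simp only: times_divide_eq_left add_divide_distrib[symmetric])
        (simp add: D_def algebra_simps)
    moreover have "\<beta> * (\<rho> t * q t) + \<kappa> * \<delta> t = d * D / D"
      unfolding \<beta>_def \<kappa>_def by (simp only: times_divide_eq_left add_divide_distrib[symmetric])
        (simp add: D_def algebra_simps)
    ultimately have "f w = f ((a / r t) *\<^sub>R X \<phi> t + \<beta> *\<^sub>R Z \<phi> t + \<kappa> *\<^sub>R \<Xi> \<phi> t)"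
      unfolding f_frame w using D r0 by (simp add: b'_def)
    thus ?thesis using f_inj by blast
  qed
  show "\<alpha> = 0 \<and> \<beta> = 0 \<and> \<kappa> = 0" if "\<alpha> *\<^sub>R X \<phi> t + \<beta> *\<^sub>R Z \<phi> t + \<kappa> *\<^sub>R \<Xi> \<phi> t = 0"
  proof -
    have "f (\<alpha> *\<^sub>R X \<phi> t + \<beta> *\<^sub>R Z \<phi> t + \<kappa> *\<^sub>R \<Xi> \<phi> t) = (0, 0, 0)" by (simp add: that f_def)
    hence 0: "\<alpha> = 0" "\<beta> * p t + \<kappa> * \<eta> t = 0" "\<beta> * (\<rho> t * q t) + \<kappa> * \<delta> t = 0"
      using r0 by (auto simp: f_frame)
    have "\<beta> * D = 0" "\<kappa> * D = 0" unfolding D_def using 0(2,3) by algebra+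
    thus ?thesis using D 0 by simp
  qed
qed

section \<open>The torus as an embedded surface\<close>

definition "torus = {E \<phi> t | \<phi> t. True}"

definition torus_map :: "real^2 \<Rightarrow> real^3" where
  "torus_map v = E (2 * pi * v$1) (T * v$2)"

text \<open>\<open>Z\<close> is a velocity in lifted time; division by \<open>\<rho>\<close> turns
  it into the derivative of \<open>E\<close> with respect to planar time.\<close>

definition torus_map_deriv :: "real^2 \<Rightarrow> real^2 \<Rightarrow> real^3" where
  "torus_map_deriv v h = (2 * pi * h$1) *\<^sub>R X (2 * pi * v$1) (T * v$2) +
     (T * h$2 / \<rho> (T * v$2)) *\<^sub>R Z (2 * pi * v$1) (T * v$2)"

lemma torus_map_range: "range torus_map = torus"
proof -
  have "E \<phi> t = torus_map (vector [\<phi> / (2 * pi), t / T])" for \<phi> t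
    using T_pos by (simp add: torus_map_def)
  thus ?thesis unfolding torus_def torus_map_def by blast
qed

text \<open>The left side ranges over all parameters of the point. They differ by periods, under
  which \<open>X\<close> and \<open>Z\<close> are invariant, so only one plane arises.\<close>

lemma tangent_space:
  "{w. \<exists>v. torus_map v = E \<phi> t \<and> w \<in> range (torus_map_deriv v)} = {\<alpha> *\<^sub>R X \<phi> t + \<beta> *\<^sub>R Z \<phi> t | \<alpha> \<beta>. True}"
  (is "?L = ?R")
proof
  show "?L \<subseteq> ?R"
  proof clarify
    fix v h assume "torus_map v = E \<phi> t"
    then obtain i j where ij: "2 * pi * v$1 = \<phi> + 2 * pi * of_int i" "T * v$2 = t + of_int j * T"
      unfolding torus_map_def E_eq_iff by blast
    show "\<exists>\<alpha> \<beta>. torus_map_deriv v h = \<alpha> *\<^sub>R X \<phi> t + \<beta> *\<^sub>R Z \<phi> t \<and> True"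
      unfolding torus_map_deriv_def ij frame_shift by blast
  qed
  show "?R \<subseteq> ?L"
  proof clarify
    fix \<alpha> \<beta>
    define v h :: "real^2" where "v = vector [\<phi> / (2 * pi), t / T]"
      and "h = vector [\<alpha> / (2 * pi), \<beta> * \<rho> t / T]"
    have "torus_map v = E \<phi> t" "torus_map_deriv v h = \<alpha> *\<^sub>R X \<phi> t + \<beta> *\<^sub>R Z \<phi> t"
      using T_pos \<rho>_pos[of t] by (simp_all add: torus_map_def torus_map_deriv_def v_def h_def)
    thus "\<exists>v. torus_map v = E \<phi> t \<and> \<alpha> *\<^sub>R X \<phi> t + \<beta> *\<^sub>R Z \<phi> t \<in> range (torus_map_deriv v)"
      by (metis rangeI)
  qed
qed

lemma torus_param_torus_map: "torus_param torus_map torus_map_deriv"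
  unfolding torus_param_def
proof (intro conjI allI)
  fix v w
  show "(torus_map has_derivative torus_map_deriv v) (at v)"
  proof -
    have "((\<lambda>v. f (T * v$2)) has_derivative (\<lambda>h. d * (T * h$2))) (at v)"
      if "(f has_real_derivative d) (at (T * v$2))" for f d
      using has_derivative_compose[OF has_derivative_mult_right[OF has_derivative_nth]
          that[unfolded has_field_derivative_def]] by (simp add: mult.commute)
    note rd = this[OF r_deriv] and zd = this[OF z_deriv]
    show ?thesis
      unfolding has_derivative_componentwise_cart[of torus_map] forall_3
      using \<rho>_pos[of "T * v$2"]
      by (auto simp: torus_map_def torus_map_deriv_def E_def Z_def q_def
          intro!: derivative_eq_intros rd has_derivative_eq_rhs[OF zd])
  qed
  show "inj (torus_map_deriv v)"
  proof (rule injI)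
    fix h h' assume "torus_map_deriv v h = torus_map_deriv v h'"
    hence "(2 * pi * (h$1 - h'$1)) *\<^sub>R X (2 * pi * v$1) (T * v$2) +
        (T * (h$2 - h'$2) / \<rho> (T * v$2)) *\<^sub>R Z (2 * pi * v$1) (T * v$2) +
        0 *\<^sub>R \<Xi> (2 * pi * v$1) (T * v$2) = 0"
      by (simp add: torus_map_deriv_def algebra_simps diff_divide_distrib)
    from frame_independent[OF this] show "h = h'"
      using T_pos \<rho>_pos[of "T * v$2"] by (simp add: vec_eq_iff forall_2)
  qed
  show "torus_map v = torus_map w \<longleftrightarrow> (\<forall>i. v$i - w$i \<in> \<int>)"
  proof -
    have "2 * pi * v$1 = 2 * pi * w$1 + 2 * pi * of_int i \<longleftrightarrow> v$1 - w$1 = of_int i" for i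
    proof -
      have "2 * pi * v$1 = 2 * pi * w$1 + 2 * pi * of_int i \<longleftrightarrow> 2 * pi * (v$1 - w$1 - of_int i) = 0"
        by (simp add: algebra_simps)
      thus ?thesis by simp
    qed
    moreover have "T * v$2 = T * w$2 + of_int i * T \<longleftrightarrow> v$2 - w$2 = of_int i" for i
    proof -
      have "T * v$2 = T * w$2 + of_int i * T \<longleftrightarrow> T * (v$2 - w$2 - of_int i) = 0"
        by (simp add: algebra_simps)
      thus ?thesis using T_pos by simp
    qed
    ultimately show ?thesis
      unfolding torus_map_def E_eq_iff forall_2 Ints_def by auto
  qed
next
  have "matrix (torus_map_deriv v) $ i $ 1 = (2 * pi) * X (2 * pi * v$1) (T * v$2) $ i"
    "matrix (torus_map_deriv v) $ i $ 2 = (T / \<rho> (T * v$2)) * Z (2 * pi * v$1) (T * v$2) $ i" for v i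
    by (simp_all add: matrix_def torus_map_deriv_def axis_def)
  moreover have "continuous_on UNIV (\<lambda>v::real^2. f (T * v$2))" if "continuous_on UNIV f"
    for f :: "real \<Rightarrow> real"
    by (rule continuous_on_compose2[OF that]) (auto intro!: continuous_intros)
  note c = this[OF data_continuous(5)] this[OF data_continuous(6)] this[OF data_continuous(3)] this[OF data_continuous(4)]
  have "continuous_on UNIV (\<lambda>v::real^2. X (2 * pi * v$1) (T * v$2) $ i)"
    "continuous_on UNIV (\<lambda>v::real^2. Z (2 * pi * v$1) (T * v$2) $ i)" for i
    using exhaust_3[of i]
    by (elim disjE; simp add: Z_def; intro continuous_intros c)+
  ultimately have "continuous_on UNIV (\<lambda>v. matrix (torus_map_deriv v) $ i $ j)" for i j
    using exhaust_2[of j] \<rho>_pos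
    by (elim disjE; simp; intro continuous_on_mult continuous_on_divide continuous_on_const c)
      (auto simp: less_imp_neq[symmetric])
  thus "continuous_on UNIV (\<lambda>v. matrix (torus_map_deriv v))"
    by (intro continuous_on_componentwise_cart)
qed

section \<open>The flow and its derivative on the torus\<close>

lemma flow_on_torus:
  assumes "\<pi> \<in> torus"
  obtains \<phi> \<tau> where "\<pi> = E \<phi> (\<tau> 0)" "\<And>s. (\<tau> has_real_derivative \<rho> (\<tau> s)) (at s)"
proof -
  obtain \<phi> t where \<pi>: "\<pi> = E \<phi> t" using assms by (auto simp: torus_def)
  \<comment> \<open>Periodicity bounds \<open>\<rho>\<close> away from zero and from above, which
    makes the time change global.\<close>
  obtain m M where "0 < m" "\<And>t. m \<le> \<rho> t" "\<And>t. \<rho> t \<le> M"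
    using periodic_positive_bounds[of T \<rho>] T_pos \<rho>_pos by auto
  from time_change_exists[OF data_continuous(6) this, of t] \<pi> show ?thesis using that by blast
qed

lemma C1_F: "C1_field F A"
  by (rule C1_field_lifted[OF C1_P C1_Q])

text \<open>An initial vector is expanded in the frame at the starting point; keeping the
  coefficients constant while the frame moves solves the variational equation.\<close>

lemma torus_solutions:
  assumes "\<pi> \<in> torus"
  shows "\<exists>g Y. ode_sol F g \<and> g 0 = \<pi> \<and> range g \<subseteq> torus \<and> variational F g Y"
proof -
  obtain \<phi> \<tau> where \<pi>: "\<pi> = E \<phi> (\<tau> 0)" and \<tau>: "\<And>s. (\<tau> has_real_derivative \<rho> (\<tau> s)) (at s)"
    using flow_on_torus[OF assms] by blast
  define g where "g s = E (\<phi> + s) (\<tau> s)" for s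
  have "\<exists>x. x 0 = v \<and> (\<forall>t. (x has_vector_derivative A (g t) *v x t) (at t))" for v
  proof -
    obtain \<alpha> \<beta> \<kappa> where v: "v = \<alpha> *\<^sub>R X \<phi> (\<tau> 0) + \<beta> *\<^sub>R Z \<phi> (\<tau> 0) + \<kappa> *\<^sub>R \<Xi> \<phi> (\<tau> 0)"
      using frame_decomposition by blast
    show ?thesis
    proof (intro exI conjI allI)
      let ?x = "\<lambda>s. \<alpha> *\<^sub>R X (\<phi> + s) (\<tau> s) + \<beta> *\<^sub>R Z (\<phi> + s) (\<tau> s) + \<kappa> *\<^sub>R \<Xi> (\<phi> + s) (\<tau> s)"
      show "?x 0 = v" by (simp add: v)
      show "(?x has_vector_derivative A (g t) *v ?x t) (at t)" for t
        unfolding g_def matrix_vector_right_distrib matrix_vector_mult_scaleR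
        by (intro has_vector_derivative_add
            bounded_linear.has_vector_derivative[OF bounded_linear_scaleR_right]
            variational_X variational_Z variational_\<Xi> \<tau>)
    qed
  qed
  from variational_exists[OF C1_F this] obtain Y where "variational F g Y" by blast
  moreover have "ode_sol F g" unfolding g_def[abs_def] by (rule ode_sol_E[OF \<tau>])
  moreover have "g 0 = \<pi>" "range g \<subseteq> torus" by (auto simp: g_def \<pi> torus_def)
  ultimately show ?thesis by blast
qed

text \<open>Normal hyperbolicity is demanded for every \<open>g\<close> and \<open>Y\<close>;
  uniqueness identifies any such pair with the explicit solutions.\<close>

lemma torus_solution_form:
  assumes "\<pi> \<in> torus" "ode_sol F g" "g 0 = \<pi>" "variational F g Y"
  obtains \<phi> \<tau> where "\<And>s. g s = E (\<phi> + s) (\<tau> s)" "\<And>s. (\<tau> has_real_derivative \<rho> (\<tau> s)) (at s)"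
    "\<And>s. Y s *v X \<phi> (\<tau> 0) = X (\<phi> + s) (\<tau> s)" "\<And>s. Y s *v Z \<phi> (\<tau> 0) = Z (\<phi> + s) (\<tau> s)"
    "\<And>s. Y s *v \<Xi> \<phi> (\<tau> 0) = \<Xi> (\<phi> + s) (\<tau> s)"
proof -
  obtain \<phi> \<tau> where \<pi>: "\<pi> = E \<phi> (\<tau> 0)" and \<tau>: "\<And>s. (\<tau> has_real_derivative \<rho> (\<tau> s)) (at s)"
    using flow_on_torus[OF assms(1)] by blast
  have g: "g s = E (\<phi> + s) (\<tau> s)" for s
    by (rule ode_sol_unique[OF C1_F assms(2) ode_sol_E[OF \<tau>], of 0]) (use assms(3) \<pi> in auto)
  note Y = variational_eq[OF C1_F assms(2,4), unfolded g]
  show ?thesis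
    using that[of \<phi> \<tau>] g \<tau> Y[OF variational_X[OF \<tau>]] Y[OF variational_Z[OF \<tau>]]
      Y[OF variational_\<Xi>[OF \<tau>]] by simp
qed

section \<open>Norm estimates and the invariant splitting\<close>

lemma norm_meridian: "norm (meridian \<phi> a b) = sqrt (a^2 + b^2)"
proof -
  have "(norm (meridian \<phi> a b))\<^sup>2 = a^2 * ((cos \<phi>)^2 + (sin \<phi>)^2) + b^2"
    by (simp only: norm_vec3 meridian_nth power_mult_distrib distrib_left)
  thus ?thesis by (metis norm_ge_zero real_sqrt_unique sin_cos_squared_add2 mult_1_right)
qed

lemma norm_tangent: "(norm (\<alpha> *\<^sub>R X \<phi> t + \<beta> *\<^sub>R Z \<phi> t))\<^sup>2 =
    \<alpha>^2 * (r t)^2 + \<beta>^2 * ((r t)^2 * (p t)^2 + (\<rho> t)^2 * (q t)^2)"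
proof -
  have "(cos \<phi>)^2 + (sin \<phi>)^2 = 1" by simp
  thus ?thesis unfolding norm_vec3 Z_def vector_add_component vector_scaleR_component X_nth
      meridian_nth real_scaleR_def by algebra
qed

text \<open>\<open>X\<close> and \<open>Z\<close> are orthogonal, and their squared lengths are
  continuous, periodic and, by \<open>transverse\<close>, positive. Vectors with equal coefficients
  thus have comparable norms everywhere, and the derivative of the flow preserves the
  coefficients.\<close>

lemma tangent_bounded:
  obtains C where "C \<ge> 1" "\<And>\<alpha> \<beta> \<phi> t \<phi>' t'.
    norm (\<alpha> *\<^sub>R X \<phi> t + \<beta> *\<^sub>R Z \<phi> t) \<le> C * norm (\<alpha> *\<^sub>R X \<phi>' t' + \<beta> *\<^sub>R Z \<phi>' t')"
proof -
  define b where "b t = (r t)^2 * (p t)^2 + (\<rho> t)^2 * (q t)^2" for t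
  have bpos: "b t > 0" for t
  proof -
    have "p t \<noteq> 0 \<or> q t \<noteq> 0" using transverse[of t] by (auto simp: p_def q_def)
    thus ?thesis using r_pos[of t] \<rho>_pos[of t] unfolding b_def
      by (auto intro: add_pos_nonneg add_nonneg_pos)
  qed
  obtain m1 M1 where 1: "0 < m1" "\<And>t. m1 \<le> (r t)^2" "\<And>t. (r t)^2 \<le> M1"
  proof (rule periodic_positive_bounds[of T "\<lambda>t. (r t)^2"])
    show "continuous_on UNIV (\<lambda>t. (r t)^2)" by (intro continuous_intros data_continuous)
    show "(r t)^2 > 0" for t using r_pos[of t] by simp
  qed (auto intro: that simp: T_pos)
  obtain m2 M2 where 2: "0 < m2" "\<And>t. m2 \<le> b t" "\<And>t. b t \<le> M2"
  proof (rule periodic_positive_bounds[of T b])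
    show "continuous_on UNIV b" unfolding b_def[abs_def] by (intro continuous_intros data_continuous)
  qed (auto intro: that simp: T_pos bpos, simp add: b_def)
  \<comment> \<open>The quotients bound squared norms; being at least 1, \<open>C\<close> is at most
    its own square and so also serves for the norms.\<close>
  define C where "C = max 1 (max (M1 / m1) (M2 / m2))"
  have C: "C \<ge> 1" "M1 \<le> C * m1" "M2 \<le> C * m2"
    using 1 2 by (auto simp: C_def pos_divide_le_eq[symmetric])
  have "norm (\<alpha> *\<^sub>R X \<phi> t + \<beta> *\<^sub>R Z \<phi> t) \<le> C * norm (\<alpha> *\<^sub>R X \<phi>' t' + \<beta> *\<^sub>R Z \<phi>' t')"
    for \<alpha> \<beta> \<phi> t \<phi>' t'
  proof (rule power2_le_imp_le)
    have r: "(r t)^2 \<le> C * (r t')^2"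
      using 1(3)[of t] C(2) mult_left_mono[OF 1(2)[of t'], of C] C(1) by linarith
    have b: "b t \<le> C * b t'"
      using 2(3)[of t] C(3) mult_left_mono[OF 2(2)[of t'], of C] C(1) by linarith
    have "(norm (\<alpha> *\<^sub>R X \<phi> t + \<beta> *\<^sub>R Z \<phi> t))\<^sup>2 = \<alpha>^2 * (r t)^2 + \<beta>^2 * b t"
      unfolding norm_tangent b_def ..
    also have "\<dots> \<le> \<alpha>^2 * (C * (r t')^2) + \<beta>^2 * (C * b t')"
      using r b by (intro add_mono mult_left_mono) auto
    also have "\<dots> = C * (norm (\<alpha> *\<^sub>R X \<phi>' t' + \<beta> *\<^sub>R Z \<phi>' t'))\<^sup>2"
      unfolding norm_tangent b_def by (simp add: algebra_simps)
    also have "\<dots> \<le> C^2 * (norm (\<alpha> *\<^sub>R X \<phi>' t' + \<beta> *\<^sub>R Z \<phi>' t'))\<^sup>2"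
      using C(1) by (intro mult_right_mono) (auto simp: power2_eq_square)
    finally show "(norm (\<alpha> *\<^sub>R X \<phi> t + \<beta> *\<^sub>R Z \<phi> t))\<^sup>2 \<le> (C * norm (\<alpha> *\<^sub>R X \<phi>' t' + \<beta> *\<^sub>R Z \<phi>' t'))\<^sup>2"
      by (simp add: power_mult_distrib)
  qed (use C in auto)
  thus ?thesis using that C(1) by blast
qed

text \<open>As in Floquet theory, \<open>\<Xi>\<close> gains the factor \<open>\<mu>\<close> over
  one period, so its norm divided by \<open>\<bar>\<mu>\<bar> powr (t / T)\<close> is periodic and
  positive, hence bounded from both sides.\<close>

lemma norm_\<Xi>_growth:
  obtains C where "C \<ge> 1"
    "\<And>\<phi> t \<phi>' t'. norm (\<Xi> \<phi>' t') \<le> C * (\<bar>\<mu>\<bar> powr ((t' - t) / T) * norm (\<Xi> \<phi> t))"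
proof -
  define N where "N t = sqrt ((r t * \<eta> t)^2 + (\<delta> t)^2)" for t
  have nN: "norm (\<Xi> \<phi> t) = N t" for \<phi> t by (simp add: \<Xi>_def norm_meridian N_def)
  have Npos: "N t > 0" for t
    using frame_independent[of 0 0 t 0 1] by (auto simp flip: nN[of 0])
  define H where "H t = N t * \<bar>\<mu>\<bar> powr (- t / T)" for t
  have N: "N t = H t * \<bar>\<mu>\<bar> powr (t / T)" for t
    using \<mu>_nz by (simp add: H_def powr_minus field_simps)
  have "H (t + T) = H t" for t
  proof -
    have "N (t + T) = \<bar>\<mu>\<bar> * N t"
      unfolding N_def
      by (simp add: power_mult_distrib real_sqrt_mult[symmetric] flip: real_sqrt_abs)
        (simp add: algebra_simps)
    moreover have "\<bar>\<mu>\<bar> powr (- (t + T) / T) = \<bar>\<mu>\<bar> powr (- t / T) / \<bar>\<mu>\<bar>"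
    proof -
      have "- (t + T) / T = - t / T - 1" using T_pos by (simp add: field_simps)
      thus ?thesis using \<mu>_nz by (simp add: powr_diff)
    qed
    ultimately show ?thesis using \<mu>_nz by (simp add: H_def)
  qed
  moreover have "continuous_on UNIV H"
    unfolding H_def[abs_def] N_def using \<mu>_nz T_pos by (intro continuous_intros data_continuous) auto
  moreover have "H t > 0" for t using Npos[of t] \<mu>_nz by (simp add: H_def)
  ultimately obtain m M where mM: "0 < m" "\<And>t. m \<le> H t" "\<And>t. H t \<le> M"
    using periodic_positive_bounds[OF T_pos] by metis
  have "M / m \<ge> 1" using mM(1) order_trans[OF mM(2,3)] by simp
  moreover have "N t' \<le> M / m * (\<bar>\<mu>\<bar> powr ((t' - t) / T) * N t)" for t t'
  proof -
    have M0: "M \<ge> 0" using mM(1) mM(2)[of 0] mM(3)[of 0] by linarith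
    have "N t' \<le> M * \<bar>\<mu>\<bar> powr (t' / T)"
      unfolding N using mM(3) by (intro mult_right_mono) auto
    also have "\<dots> = M / m * (\<bar>\<mu>\<bar> powr ((t' - t) / T) * (m * \<bar>\<mu>\<bar> powr (t / T)))"
      using mM(1) \<mu>_nz by (simp add: diff_divide_distrib powr_diff)
    also have "\<dots> \<le> M / m * (\<bar>\<mu>\<bar> powr ((t' - t) / T) * N t)"
      unfolding N[of t] using mM M0 by (intro mult_left_mono mult_right_mono) auto
    finally show ?thesis .
  qed
  ultimately show ?thesis using that nN by metis
qed

text \<open>A point determines \<open>\<phi>\<close> and \<open>t\<close> only up to periods, and
  \<open>\<Xi>\<close> only up to powers of \<open>\<mu>\<close>; the line spanned is nevertheless a
  function of the point.\<close>

definition normal_line :: "real^3 \<Rightarrow> (real^3) set" where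
  "normal_line \<pi> = {c *\<^sub>R \<Xi> \<phi> t | c \<phi> t. \<pi> = E \<phi> t}"

lemma normal_line_E: "normal_line (E \<phi> t) = range (\<lambda>c. c *\<^sub>R \<Xi> \<phi> t)"
proof
  show "normal_line (E \<phi> t) \<subseteq> range (\<lambda>c. c *\<^sub>R \<Xi> \<phi> t)"
  proof
    fix w assume "w \<in> normal_line (E \<phi> t)"
    then obtain c \<phi>' t' where w: "w = c *\<^sub>R \<Xi> \<phi>' t'" and "E \<phi>' t' = E \<phi> t"
      by (auto simp: normal_line_def)
    then obtain i j where "\<phi>' = \<phi> + 2 * pi * of_int i" "t' = t + of_int j * T"
      using E_eq_iff by blast
    hence "w = (c * \<mu> powi j) *\<^sub>R \<Xi> \<phi> t" using w frame_shift(4) by simp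
    thus "w \<in> range (\<lambda>c. c *\<^sub>R \<Xi> \<phi> t)" by blast
  qed
qed (auto simp: normal_line_def)

lemma direct_sum_E:
  "direct_sum3 {\<alpha> *\<^sub>R X \<phi> t + \<beta> *\<^sub>R Z \<phi> t | \<alpha> \<beta>. True} (normal_line (E \<phi> t)) {0}"
  "direct_sum3 {\<alpha> *\<^sub>R X \<phi> t + \<beta> *\<^sub>R Z \<phi> t | \<alpha> \<beta>. True} {0} (normal_line (E \<phi> t))"
  unfolding direct_sum3_def normal_line_E
  using frame_independent[of _ \<phi> t] frame_decomposition[of _ \<phi> t] by fastforce+

lemma subspace_normal_line: "\<pi> \<in> torus \<Longrightarrow> subspace (normal_line \<pi>)"
proof -
  assume "\<pi> \<in> torus"
  then obtain \<phi> t where "\<pi> = E \<phi> t" by (auto simp: torus_def)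
  hence "normal_line \<pi> = span {\<Xi> \<phi> t}" by (simp add: normal_line_E span_singleton)
  thus ?thesis by simp
qed

lemma nh_invariant_torus: "nh_invariant_torus F torus"
proof -
  obtain C1 where C1: "C1 \<ge> 1" "\<And>\<alpha> \<beta> \<phi> t \<phi>' t'.
    norm (\<alpha> *\<^sub>R X \<phi> t + \<beta> *\<^sub>R Z \<phi> t) \<le> C1 * norm (\<alpha> *\<^sub>R X \<phi>' t' + \<beta> *\<^sub>R Z \<phi>' t')"
    using tangent_bounded by blast
  obtain C2 where C2: "C2 \<ge> 1"
    "\<And>\<phi> t \<phi>' t'. norm (\<Xi> \<phi>' t') \<le> C2 * (\<bar>\<mu>\<bar> powr ((t' - t) / T) * norm (\<Xi> \<phi> t))"
    using norm_\<Xi>_growth by blast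
  obtain c M where c: "0 < c" "\<And>t. c \<le> \<rho> t" and "\<And>t. \<rho> t \<le> M"
    using periodic_positive_bounds[of T \<rho>] T_pos \<rho>_pos by auto
  define C where "C = max C1 C2"
  \<comment> \<open>Planar time advances by at least \<open>c\<close> per unit of lifted time, and
    per unit of planar time the logarithm of the norm of \<open>\<Xi>\<close> changes on average by
    \<open>ln \<bar>\<mu>\<bar> / T\<close>.\<close>
  define b where "b = c * \<bar>ln \<bar>\<mu>\<bar>\<bar> / T"
  have b: "b > 0" using c T_pos \<mu>_hyp \<mu>_nz by (simp add: b_def)
  \<comment> \<open>The normal line is stable or unstable according to
    \<open>\<bar>\<mu>\<bar>\<close>; the other summand is trivial.\<close>
  define Es where "Es = (if \<bar>\<mu>\<bar> < 1 then normal_line else (\<lambda>_. {0}))"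
  define Eu where "Eu = (if \<bar>\<mu>\<bar> < 1 then (\<lambda>_. {0}) else normal_line)"
  let ?Tan = "\<lambda>\<pi>. {w. \<exists>v. torus_map v = \<pi> \<and> w \<in> range (torus_map_deriv v)}"
  have splitting: "subspace (Es \<pi>) \<and> subspace (Eu \<pi>) \<and> direct_sum3 (?Tan \<pi>) (Es \<pi>) (Eu \<pi>)"
    if "\<pi> \<in> torus" for \<pi>
    using that subspace_normal_line[OF that] direct_sum_E
    by (auto simp: Es_def Eu_def torus_def tangent_space)
  \<comment> \<open>The two alternatives cover an attracting cycle followed forwards and a repelling
    one followed backwards.\<close>
  have rate: "\<bar>\<mu>\<bar> powr (d / T) \<le> exp (- b * t)"
    if "\<bar>\<mu>\<bar> < 1 \<and> c * t \<le> d \<or> \<bar>\<mu>\<bar> > 1 \<and> c * t \<le> - d" for t d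
  proof -
    have "d * ln \<bar>\<mu>\<bar> \<le> - (c * t) * \<bar>ln \<bar>\<mu>\<bar>\<bar>"
      using that mult_right_mono[of "c * t" d "- ln \<bar>\<mu>\<bar>"] mult_right_mono[of "c * t" "-d" "ln \<bar>\<mu>\<bar>"]
        \<mu>_nz by auto
    hence "d * ln \<bar>\<mu>\<bar> / T \<le> - (c * t) * \<bar>ln \<bar>\<mu>\<bar>\<bar> / T"
      using T_pos by (intro divide_right_mono) auto
    thus ?thesis using \<mu>_nz by (simp add: powr_def b_def mult.commute mult.left_commute)
  qed
  have dynamics: "(\<forall>t. (\<lambda>v. Y t *v v) ` Es \<pi> = Es (g t) \<and> (\<lambda>v. Y t *v v) ` Eu \<pi> = Eu (g t)) \<and>
      (\<forall>t\<ge>0. \<forall>v\<in>Es \<pi>. norm (Y t *v v) \<le> C * exp (- b * t) * norm v) \<and>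
      (\<forall>t\<ge>0. \<forall>v\<in>Eu \<pi>. norm (Y (- t) *v v) \<le> C * exp (- b * t) * norm v) \<and>
      (\<forall>t\<ge>0. \<forall>w\<in>?Tan \<pi>. exp (- (b / 2) * t) * norm w \<le> C * norm (Y t *v w) \<and>
         exp (- (b / 2) * t) * norm w \<le> C * norm (Y (- t) *v w))"
    if \<pi>: "\<pi> \<in> torus" and g: "ode_sol F g" "g 0 = \<pi>" and Y: "variational F g Y" for \<pi> g Y
  proof -
    obtain \<phi> \<tau> where gE: "\<And>s. g s = E (\<phi> + s) (\<tau> s)"
      and \<tau>: "\<And>s. (\<tau> has_real_derivative \<rho> (\<tau> s)) (at s)"
      and YX: "\<And>s. Y s *v X \<phi> (\<tau> 0) = X (\<phi> + s) (\<tau> s)"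
      and YZ: "\<And>s. Y s *v Z \<phi> (\<tau> 0) = Z (\<phi> + s) (\<tau> s)"
      and Y\<Xi>: "\<And>s. Y s *v \<Xi> \<phi> (\<tau> 0) = \<Xi> (\<phi> + s) (\<tau> s)"
      using torus_solution_form[OF \<pi> g Y] by blast
    have \<pi>E: "\<pi> = E \<phi> (\<tau> 0)" using gE[of 0] g(2) by simp
    have \<tau>_grow: "c * (t - s) \<le> \<tau> t - \<tau> s" if "s \<le> t" for s t
    proof -
      have "\<tau> s - c * s \<le> \<tau> t - c * t"
        by (rule DERIV_nonneg_imp_nondecreasing[OF that, of "\<lambda>x. \<tau> x - c * x"])
          (use \<tau> c(2) in \<open>force intro!: derivative_eq_intros exI[of _ "\<rho> (\<tau> _) - c"]\<close>)
      thus ?thesis by (simp add: algebra_simps)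
    qed
    have lineY: "(\<lambda>v. Y t *v v) ` normal_line \<pi> = normal_line (g t)" for t
      unfolding \<pi>E gE normal_line_E image_image matrix_vector_mult_scaleR Y\<Xi> ..
    have contr: "norm (Y s *v v) \<le> C * exp (- b * t) * norm v"
      if v: "v \<in> normal_line \<pi>" and
        s: "\<bar>\<mu>\<bar> < 1 \<and> c * t \<le> \<tau> s - \<tau> 0 \<or> \<bar>\<mu>\<bar> > 1 \<and> c * t \<le> - (\<tau> s - \<tau> 0)" for v s t
    proof -
      obtain x where x: "v = x *\<^sub>R \<Xi> \<phi> (\<tau> 0)" using v by (auto simp: \<pi>E normal_line_E)
      have "norm (Y s *v v) = \<bar>x\<bar> * norm (\<Xi> (\<phi> + s) (\<tau> s))"
        by (simp add: x matrix_vector_mult_scaleR Y\<Xi>)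
      also have "\<dots> \<le> \<bar>x\<bar> * (C2 * (\<bar>\<mu>\<bar> powr ((\<tau> s - \<tau> 0) / T) * norm (\<Xi> \<phi> (\<tau> 0))))"
        by (intro mult_left_mono C2) auto
      also have "\<dots> \<le> \<bar>x\<bar> * (C * (exp (- b * t) * norm (\<Xi> \<phi> (\<tau> 0))))"
        using C2(1) rate[OF s] by (intro mult_left_mono mult_mono) (auto simp: C_def)
      also have "\<dots> = C * exp (- b * t) * norm v" by (simp add: x)
      finally show ?thesis .
    qed
    \<comment> \<open>Tangential norms change at most by the factor \<open>C1\<close> for all times,
      so any positive rate is admissible; \<open>b / 2\<close> is chosen to stay below
      \<open>b\<close>.\<close>
    have tang: "exp (- (b / 2) * t) * norm w \<le> C * norm (Y s *v w)"
      if w: "w \<in> ?Tan \<pi>" and t: "t \<ge> 0" for w s t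
    proof -
      obtain \<alpha> \<beta> where w': "w = \<alpha> *\<^sub>R X \<phi> (\<tau> 0) + \<beta> *\<^sub>R Z \<phi> (\<tau> 0)"
        using w unfolding \<pi>E tangent_space by blast
      have "exp (- (b / 2) * t) * norm w \<le> norm w"
        using b t by (intro mult_left_le_one_le) auto
      also have "\<dots> \<le> C1 * norm (Y s *v w)"
        unfolding w' matrix_vector_right_distrib matrix_vector_mult_scaleR YX YZ by (rule C1)
      also have "\<dots> \<le> C * norm (Y s *v w)" by (intro mult_right_mono) (auto simp: C_def)
      finally show ?thesis .
    qed
    have fwd: "c * t \<le> \<tau> t - \<tau> 0" "c * t \<le> - (\<tau> (- t) - \<tau> 0)" if "t \<ge> 0" for t
      using \<tau>_grow[of 0 t] \<tau>_grow[of "- t" 0] that by auto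
    have mu_cases: "\<not> \<bar>\<mu>\<bar> < 1 \<Longrightarrow> \<bar>\<mu>\<bar> > 1" using \<mu>_hyp by auto
    have C0: "C \<ge> 0" using C1(1) by (simp add: C_def)
    show ?thesis
    proof (intro conjI allI impI ballI)
      fix t
      show "(\<lambda>v. Y t *v v) ` Es \<pi> = Es (g t)" "(\<lambda>v. Y t *v v) ` Eu \<pi> = Eu (g t)"
        using lineY[of t] by (simp_all add: Es_def Eu_def)
    next
      fix t :: real and v assume t: "t \<ge> 0"
      show "norm (Y t *v v) \<le> C * exp (- b * t) * norm v" if "v \<in> Es \<pi>"
        using that contr[of v t t] fwd[OF t] by (auto simp: Es_def split: if_splits)
      show "norm (Y (- t) *v v) \<le> C * exp (- b * t) * norm v" if "v \<in> Eu \<pi>"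
        using that contr[of v t "- t"] fwd[OF t] mu_cases by (auto simp: Eu_def split: if_splits)
      show "exp (- (b / 2) * t) * norm v \<le> C * norm (Y t *v v)"
        "exp (- (b / 2) * t) * norm v \<le> C * norm (Y (- t) *v v)" if "v \<in> ?Tan \<pi>"
        using tang[OF that t] by auto
    qed
  qed
  show ?thesis
    unfolding nh_invariant_torus_def Let_def
  proof (rule exI[of _ torus_map], rule exI[of _ torus_map_deriv], intro conjI)
    show "torus_param torus_map torus_map_deriv" by (rule torus_param_torus_map)
    show "torus = range torus_map" by (simp add: torus_map_range)
    show "\<forall>p\<in>torus. \<exists>g Y. ode_sol F g \<and> g 0 = p \<and> range g \<subseteq> torus \<and> variational F g Y"
      using torus_solutions by blast
    show "\<exists>Es Eu C a b. 1 \<le> C \<and> 0 < a \<and> a < b \<and>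
       (\<forall>p\<in>torus. subspace (Es p) \<and> subspace (Eu p) \<and> direct_sum3 (?Tan p) (Es p) (Eu p)) \<and>
       (\<forall>p\<in>torus. \<forall>g Y. ode_sol F g \<and> g 0 = p \<and> variational F g Y \<longrightarrow>
          (\<forall>t. (\<lambda>v. Y t *v v) ` Es p = Es (g t) \<and> (\<lambda>v. Y t *v v) ` Eu p = Eu (g t)) \<and>
          (\<forall>t\<ge>0. \<forall>v\<in>Es p. norm (Y t *v v) \<le> C * exp (- b * t) * norm v) \<and>
          (\<forall>t\<ge>0. \<forall>v\<in>Eu p. norm (Y (- t) *v v) \<le> C * exp (- b * t) * norm v) \<and>
          (\<forall>t\<ge>0. \<forall>w\<in>?Tan p. exp (- a * t) * norm w \<le> C * norm (Y t *v w) \<and>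
                              exp (- a * t) * norm w \<le> C * norm (Y (- t) *v w)))"
    proof (rule exI[of _ Es], rule exI[of _ Eu], rule exI[of _ C], rule exI[of _ "b / 2"],
        rule exI[of _ b], intro conjI)
      show "C \<ge> 1" "0 < b / 2" "b / 2 < b" using C1(1) b by (auto simp: C_def)
      show "\<forall>p\<in>torus. subspace (Es p) \<and> subspace (Eu p) \<and> direct_sum3 (?Tan p) (Es p) (Eu p)"
        using splitting by blast
    qed (intro ballI allI impI dynamics; auto)
  qed
qed

end

section \<open>From planar cycles to tori\<close>

text \<open>For a primitive \<open>G\<close>, the defect \<open>G (t + T) - \<mu> * G t\<close> has
  derivative zero. Adding a constant \<open>x\<close> to \<open>G\<close> changes the defect by
  \<open>(1 - \<mu>) * x\<close>, so it can be removed when \<open>\<mu>\<close> is not 1.\<close>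

lemma multiplier_antiderivative:
  fixes f :: "real \<Rightarrow> real"
  assumes c: "continuous_on UNIV f" and per: "\<And>t. f (t + T) = \<mu> * f t" and \<mu>: "\<mu> \<noteq> 1"
  shows "\<exists>k. (\<forall>t. (k has_real_derivative f t) (at t)) \<and> (\<forall>t. k (t + T) = \<mu> * k t)"
proof -
  obtain G where G: "\<And>t. (G has_real_derivative f t) (at t)" using antiderivative_real[OF c] by blast
  define d where "d t = G (t + T) - \<mu> * G t" for t
  have "(d has_real_derivative 0) (at t)" for t
  proof -
    have "((\<lambda>t. G (t + T)) has_real_derivative f (t + T)) (at t)"
      using G[of "t + T"] by (simp add: DERIV_shift)
    thus ?thesis unfolding d_def[abs_def] using G[of t]
      by (auto intro!: derivative_eq_intros simp: per)
  qed
  hence d: "d t = d 0" for t using DERIV_isconst_all by blast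
  define k where "k t = G t + d 0 / (\<mu> - 1)" for t
  have "(k has_real_derivative f t) (at t)" for t
    unfolding k_def[abs_def] using G[of t] by (auto intro!: derivative_eq_intros)
  moreover have "k (t + T) = \<mu> * k t" for t
  proof -
    have "d 0 = (\<mu> - 1) * (d 0 / (\<mu> - 1))" using \<mu> by simp
    thus ?thesis using d[of t] unfolding k_def d_def[of t] by (simp only: algebra_simps)
  qed
  ultimately show ?thesis by blast
qed

context planar_cycle_lift
begin

text \<open>Describing the torus as the preimage of the cycle, without reference to its
  parametrization, lets different cycles be told apart by their tori.\<close>

lemma torus_eq: "torus = {w. vector [(w$1)^2 + (w$2)^2 - K, w$3] \<in> range (\<lambda>t. vector [u t, z t] :: real^2)}"
  (is "_ = ?R")
proof
  show "torus \<subseteq> ?R"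
    using E_radius by (auto simp: torus_def E_def)
  show "?R \<subseteq> torus"
  proof clarify
    fix w :: "real^3" and t
    assume *: "vector [(w$1)^2 + (w$2)^2 - K, w$3] = (vector [u t, z t] :: real^2)"
    have u: "(w$1)^2 + (w$2)^2 = (r t)^2" and z: "w$3 = z t"
      using arg_cong[OF *, of "\<lambda>v. v $ 1"] arg_cong[OF *, of "\<lambda>v. v $ 2"] by (simp_all add: r_sq)
    have "(w$1 / r t)^2 + (w$2 / r t)^2 = 1"
      using u r_pos[of t] by (simp add: power_divide add_divide_distrib[symmetric])
    then obtain \<phi> where "w$1 / r t = cos \<phi>" "w$2 / r t = sin \<phi>"
      by (metis sincos_total_2pi)
    hence "w = E \<phi> t" using z r_pos[of t] by (auto simp: vec3_eq_iff E_def field_simps)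
    thus "w \<in> torus" by (auto simp: torus_def)
  qed
qed

end

text \<open>The data of \<open>planar_cycle_lift\<close> come from an eigenvector of the monodromy
  matrix \<open>Y T\<close> for \<open>\<mu>\<close>, transported along the cycle by
  \<open>Y\<close>.\<close>

lemma nh_invariant_torus_lift:
  fixes P Q :: "real \<Rightarrow> real \<Rightarrow> real"
  assumes C1: "C1_fun2 P Pu Pz" "C1_fun2 Q Qu Qz"
    and cyc: "hyperbolic_limit_cycle (field2 P Q) \<Gamma>"
    and K: "\<And>v. v \<in> \<Gamma> \<Longrightarrow> v$1 + K > 0"
  shows "nh_invariant_torus (lifted_field P Q K) {w. vector [(w$1)^2 + (w$2)^2 - K, w$3] \<in> \<Gamma>}"
proof -
  define F where "F = field2 P Q"
  define A where "A = planar_jac Pu Pz Qu Qz"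
  have F: "C1_field F A" unfolding F_def A_def by (rule C1_field_planar[OF C1])
  obtain g T Y \<mu> where per: "periodic_param F \<Gamma> g T" and Y: "variational F g Y"
    and \<mu>: "\<bar>\<mu>\<bar> \<noteq> 1" and char: "\<And>s::real. det (s *\<^sub>R mat 1 - Y T) = (s - 1) * (s - \<mu>)"
    using cyc unfolding hyperbolic_limit_cycle_def F_def by blast
  have g: "ode_sol F g" and T: "T > 0" and gT: "\<And>t. g (t + T) = g t"
    and g_prime: "\<And>s. 0 < s \<Longrightarrow> s < T \<Longrightarrow> g s \<noteq> g 0" and \<Gamma>: "\<Gamma> = range g"
    using per by (auto simp: periodic_param_def)
  \<comment> \<open>Uniqueness makes \<open>s - t\<close> a period; its remainder modulo
    \<open>T\<close> vanishes because \<open>T\<close> is the least positive period.\<close>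
  have inj: "\<exists>j::int. s = t + of_int j * T" if "g s = g t" for s t
  proof -
    have "g (- t + s) = g (- t + t)"
      by (rule ode_sol_unique[OF F ode_sol_shift[OF g, of s] ode_sol_shift[OF g, of t], of 0])
        (use that in simp)
    hence eq: "g (s - t) = g 0" by simp
    obtain j :: int and d where d: "s - t = d + of_int j * T" "0 \<le> d" "d < T"
      using exists_period_representative[OF T] by blast
    have "g d = g 0" using eq d(1) periodic_int_shift[of g T d j] gT by simp
    hence "d = 0" using g_prime[of d] d by force
    thus ?thesis using d(1) by (auto simp: algebra_simps)
  qed
  \<comment> \<open>A zero of the field would be an equilibrium and force \<open>g\<close> to be
    constant.\<close>
  have F_nz: "F (g t) \<noteq> 0" for t
  proof
    assume "F (g t) = 0"
    hence c: "ode_sol F (\<lambda>_. g t)" by (simp add: ode_sol_def)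
    have "g s = g t" for s by (rule ode_sol_unique[OF F g c, of t]) simp
    hence "g (T / 2) = g 0" by metis
    thus False using g_prime[of "T / 2"] T by simp
  qed
  have Y0: "Y 0 *v w = w" for w using Y by (simp add: variational_def)
  have YF: "Y t *v F (g 0) = F (g t)" for t
    by (rule variational_eq[OF F g Y field_along_solution[OF F g]])
  note YD = variational_solution[OF F Y]
  have contA: "continuous_on UNIV (\<lambda>t. A (g t))"
    using F ode_sol_continuous_on[OF g] by (auto simp: C1_field_def intro: continuous_on_compose2)
  have Y_inj: "w = 0" if "Y t *v w = 0" for t w
  proof -
    have "Y 0 *v w = 0"
      by (rule linear_ode_unique[OF contA YD, of "\<lambda>_. 0" t]) (use that in simp_all)
    thus ?thesis by (simp add: Y0)
  qed
  \<comment> \<open>The characteristic polynomial vanishes at \<open>\<mu>\<close>, which yields an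
    eigenvector.\<close>
  have "\<not> invertible (\<mu> *\<^sub>R mat 1 - Y T)" using char[of \<mu>] by (simp add: invertible_det_nz)
  hence "\<exists>v. v \<noteq> 0 \<and> (\<mu> *\<^sub>R mat 1 - Y T) *v v = 0"
    by (metis invertible_left_inverse matrix_left_invertible_ker)
  then obtain v where v: "v \<noteq> 0" and "(\<mu> *\<^sub>R mat 1 - Y T) *v v = 0" by blast
  hence YTv: "Y T *v v = \<mu> *\<^sub>R v"
    by (simp add: matrix_vector_mult_diff_rdistrib scaleR_matrix_vector_assoc[symmetric])
  have \<mu>0: "\<mu> \<noteq> 0" using YTv Y_inj v by auto
  define n where "n t = Y t *v v" for t
  have n_deriv: "(n has_vector_derivative A (g t) *v n t) (at t)" for t
    unfolding n_def by (rule YD)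
  \<comment> \<open>Both sides solve the same linear equation, the coefficients being
    \<open>T\<close>-periodic, and they agree at 0 by the choice of \<open>v\<close>.\<close>
  have nT: "n (t + T) = \<mu> *\<^sub>R n t" for t
  proof (rule linear_ode_unique[OF contA, of "\<lambda>t. n (t + T)" "\<lambda>t. \<mu> *\<^sub>R n t" 0])
    show "((\<lambda>t. n (t + T)) has_vector_derivative A (g t) *v n (t + T)) (at t)" for t
    proof -
      have "((n \<circ> (\<lambda>t. t + T)) has_vector_derivative 1 *\<^sub>R (A (g (t + T)) *v n (t + T))) (at t)"
        by (rule vector_diff_chain_at) (auto intro!: derivative_eq_intros n_deriv)
      thus ?thesis by (simp add: o_def gT)
    qed
    show "((\<lambda>t. \<mu> *\<^sub>R n t) has_vector_derivative A (g t) *v (\<mu> *\<^sub>R n t)) (at t)" for t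
      unfolding matrix_vector_mult_scaleR
      by (rule bounded_linear.has_vector_derivative[OF bounded_linear_scaleR_right n_deriv])
  qed (simp add: n_def YTv Y0)
  \<comment> \<open>If \<open>n\<close> were parallel to the field at one time, the eigenvector
    would be a multiple of \<open>F (g 0)\<close>, which \<open>Y T\<close> fixes; then
    \<open>\<mu>\<close> would be 1.\<close>
  have transverse: "F (g t) $ 1 * n t $ 2 - F (g t) $ 2 * n t $ 1 \<noteq> 0" for t
  proof
    assume *: "F (g t) $ 1 * n t $ 2 - F (g t) $ 2 * n t $ 1 = 0"
    have "\<exists>c. n t = c *\<^sub>R F (g t)"
    proof (cases "F (g t) $ 1 = 0")
      case True
      hence "F (g t) $ 2 \<noteq> 0" using F_nz[of t] by (auto simp: vec_eq_iff forall_2)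
      thus ?thesis using * True
        by (intro exI[of _ "n t $ 2 / F (g t) $ 2"]) (auto simp: vec_eq_iff forall_2)
    next
      case False
      thus ?thesis using *
        by (intro exI[of _ "n t $ 1 / F (g t) $ 1"]) (auto simp: vec_eq_iff forall_2 field_simps)
    qed
    then obtain c where "n t = c *\<^sub>R F (g t)" by blast
    hence "Y t *v (v - c *\<^sub>R F (g 0)) = 0"
      by (simp add: matrix_vector_mult_diff_distrib matrix_vector_mult_scaleR YF n_def)
    hence "v = c *\<^sub>R F (g 0)" using Y_inj by fastforce
    hence "Y T *v v = v" using YF[of T] gT[of 0] by (simp add: matrix_vector_mult_scaleR)
    hence "(\<mu> - 1) *\<^sub>R v = 0" using YTv by (simp add: scaleR_diff_left)
    thus False using v \<mu> by auto
  qed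
  define u z where "u t = g t $ 1" and "z t = g t $ 2" for t
  have g_uz: "g t = vector [u t, z t]" for t by (simp add: u_def z_def vec_eq_iff forall_2)
  have u_gt: "u t + K > 0" for t using K[of "g t"] by (simp add: \<Gamma> u_def)
  have gc: "((\<lambda>t. g t $ i) has_real_derivative F (g t) $ i) (at t)" for i t
    using g by (simp add: ode_sol_componentwise)
  have nc: "((\<lambda>t. n t $ i) has_real_derivative (A (g t) *v n t) $ i) (at t)" for i t
    using n_deriv[of t] unfolding has_vector_derivative_componentwise_cart[of n]
    by (simp add: has_real_derivative_iff_has_vector_derivative)
  \<comment> \<open>The integrand inherits the multiplier \<open>\<mu>\<close> from
    \<open>n\<close>, while \<open>u\<close> is periodic.\<close>
  have "\<exists>k. (\<forall>t. (k has_real_derivative 2 * n t $ 1 / (2 * (u t + K))^2) (at t)) \<and>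
      (\<forall>t. k (t + T) = \<mu> * k t)"
  proof (rule multiplier_antiderivative)
    have "continuous_on UNIV (\<lambda>t. n t $ 1)" "continuous_on UNIV u"
      unfolding u_def[abs_def]
      by (intro continuous_at_imp_continuous_on ballI DERIV_isCont[OF nc] DERIV_isCont[OF gc])+
    moreover have "(2 * (u t + K))^2 \<noteq> 0" for t using u_gt[of t] by simp
    ultimately show "continuous_on UNIV (\<lambda>t. 2 * n t $ 1 / (2 * (u t + K))^2)"
      by (intro continuous_on_divide continuous_on_mult continuous_on_power continuous_on_add
          continuous_on_const) auto
  qed (use \<mu> in \<open>auto simp: nT gT u_def\<close>)
  then obtain k where k: "\<And>t. (k has_real_derivative 2 * n t $ 1 / (2 * (u t + K))^2) (at t)"
    "\<And>t. k (t + T) = \<mu> * k t" by blast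
  interpret planar_cycle_lift P Q Pu Pz Qu Qz K T \<mu> u z "\<lambda>t. n t $ 1" "\<lambda>t. n t $ 2" k
  proof
    fix s t
    show "\<exists>j::int. s = t + of_int j * T" if "u s = u t" "z s = z t"
      using that by (intro inj) (simp add: g_uz)
    show "(u has_real_derivative P (u t) (z t)) (at t)" "(z has_real_derivative Q (u t) (z t)) (at t)"
      using gc[of 1 t] gc[of 2 t] by (simp_all add: u_def[abs_def] z_def[abs_def] F_def)
    show "((\<lambda>t. n t $ 1) has_real_derivative Pu (u t) (z t) * n t $ 1 + Pz (u t) (z t) * n t $ 2) (at t)"
      "((\<lambda>t. n t $ 2) has_real_derivative Qu (u t) (z t) * n t $ 1 + Qz (u t) (z t) * n t $ 2) (at t)"
      using nc[of 1 t] nc[of 2 t] by (simp_all add: u_def z_def A_def)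
    show "P (u t) (z t) * n t $ 2 - Q (u t) (z t) * n t $ 1 \<noteq> 0"
      using transverse[of t] by (simp add: u_def z_def F_def)
  qed (use C1 T gT u_gt k nT \<mu> \<mu>0 in \<open>simp_all add: u_def z_def\<close>)
  show ?thesis
    using nh_invariant_torus unfolding torus_eq \<Gamma> g_uz[abs_def] by simp
qed

section \<open>Smoothness and degrees of polynomials\<close>

lemma C1_fun2_sum:
  assumes "\<And>i. i \<in> I \<Longrightarrow> C1_fun2 (f i) (fu i) (fz i)"
  shows "C1_fun2 (\<lambda>x y. \<Sum>i\<in>I. f i x y) (\<lambda>x y. \<Sum>i\<in>I. fu i x y) (\<lambda>x y. \<Sum>i\<in>I. fz i x y)"
  unfolding C1_fun2_def
proof (intro conjI allI)
  show "continuous_on UNIV (\<lambda>v. \<Sum>i\<in>I. fu i (fst v) (snd v))"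
    "continuous_on UNIV (\<lambda>v. \<Sum>i\<in>I. fz i (fst v) (snd v))"
    using assms by (auto simp: C1_fun2_def intro!: continuous_on_sum)
  fix a b
  have "((\<lambda>v. \<Sum>i\<in>I. f i (fst v) (snd v)) has_derivative
      (\<lambda>h. \<Sum>i\<in>I. fu i a b * fst h + fz i a b * snd h)) (at (a, b))"
    using assms by (intro has_derivative_sum) (auto simp: C1_fun2_def)
  thus "((\<lambda>v. \<Sum>i\<in>I. f i (fst v) (snd v)) has_derivative
      (\<lambda>h. (\<Sum>i\<in>I. fu i a b) * fst h + (\<Sum>i\<in>I. fz i a b) * snd h)) (at (a, b))"
    by (simp add: sum.distrib sum_distrib_right)
qed

text \<open>For exponent 0 the truncated subtraction does no harm, since the factor
  \<open>of_nat i\<close> or \<open>of_nat j\<close> is zero.\<close>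

lemma C1_fun2_monomial:
  "C1_fun2 (\<lambda>x y. c * x ^ i * y ^ j) (\<lambda>x y. c * (of_nat i * x ^ (i - 1)) * y ^ j)
     (\<lambda>x y. c * x ^ i * (of_nat j * y ^ (j - 1)))"
  unfolding C1_fun2_def
  by (auto intro!: continuous_intros derivative_eq_intros simp: fun_eq_iff algebra_simps)

lemma poly2_deg_le_C1: "poly2_deg_le k P \<Longrightarrow> \<exists>Pu Pz. C1_fun2 P Pu Pz"
proof -
  assume "poly2_deg_le k P"
  then obtain c where "P = (\<lambda>x y. \<Sum>i\<le>k. \<Sum>j\<le>k - i. c i j * x ^ i * y ^ j)"
    by (auto simp: poly2_deg_le_def fun_eq_iff)
  thus ?thesis by (simp only:) ((rule exI)+, rule C1_fun2_sum, rule C1_fun2_sum, rule C1_fun2_monomial)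
qed

lemma poly3_monomial:
  assumes "i + j + l \<le> k"
  shows "poly3_deg_le k (\<lambda>x y z. c * x ^ i * y ^ j * z ^ l)"
  unfolding poly3_deg_le_def
proof (intro exI[of _ "\<lambda>i' j' l'. if i' = i \<and> j' = j \<and> l' = l then c else 0"] allI)
  fix x y z :: real
  let ?t = "c * x ^ i * y ^ j * z ^ l"
  have 1: "(\<Sum>l'\<le>k - i' - j'. (if i' = i \<and> j' = j \<and> l' = l then c else 0) * x ^ i' * y ^ j' * z ^ l') =
      (if i' = i \<and> j' = j then ?t else 0)" for i' j'
  proof (cases "i' = i \<and> j' = j")
    case True
    have "(\<Sum>l'\<le>k - i - j. (if l' = l then c else 0) * x ^ i * y ^ j * z ^ l') =
        (\<Sum>l'\<le>k - i - j. if l' = l then ?t else 0)"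
      by (intro sum.cong) auto
    thus ?thesis using True assms by simp
  qed auto
  have 2: "(\<Sum>j'\<le>k - i'. if i' = i \<and> j' = j then ?t else 0) = (if i' = i then ?t else 0)" for i'
    using assms by (cases "i' = i") auto
  show "?t = (\<Sum>i'\<le>k. \<Sum>j'\<le>k - i'. \<Sum>l'\<le>k - i' - j'.
      (if i' = i \<and> j' = j \<and> l' = l then c else 0) * x ^ i' * y ^ j' * z ^ l')"
    unfolding 1 2 using assms by simp
qed

lemma poly3_add:
  assumes "poly3_deg_le k f" "poly3_deg_le k g"
  shows "poly3_deg_le k (\<lambda>x y z. f x y z + g x y z)"
proof -
  obtain c d where "\<And>x y z. f x y z = (\<Sum>i\<le>k. \<Sum>j\<le>k - i. \<Sum>l\<le>k - i - j. c i j l * x ^ i * y ^ j * z ^ l)"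
    "\<And>x y z. g x y z = (\<Sum>i\<le>k. \<Sum>j\<le>k - i. \<Sum>l\<le>k - i - j. d i j l * x ^ i * y ^ j * z ^ l)"
    using assms unfolding poly3_deg_le_def by blast
  thus ?thesis unfolding poly3_deg_le_def
    by (intro exI[of _ "\<lambda>i j l. c i j l + d i j l"]) (simp add: distrib_right sum.distrib)
qed

lemma poly3_sum:
  assumes "\<And>i. i \<in> I \<Longrightarrow> poly3_deg_le k (f i)"
  shows "poly3_deg_le k (\<lambda>x y z. \<Sum>i\<in>I. f i x y z)"
  using assms
proof (induction I rule: infinite_finite_induct)
  case (insert i I)
  thus ?case using poly3_add[of k "f i"] by simp
qed (use poly3_monomial[of 0 0 0 k 0] in simp_all)

text \<open>A product is linear in its first factor, so its degree need only be bounded for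
  monomials there. With \<open>g\<close> equal to 1 this gives monotonicity in the degree; used once
  for each factor, it gives the product rule.\<close>

lemma poly3_induct_monomials:
  assumes f: "poly3_deg_le k f"
    and mono: "\<And>c i j l. i + j + l \<le> k \<Longrightarrow> poly3_deg_le k' (\<lambda>x y z. c * x ^ i * y ^ j * z ^ l * g x y z)"
  shows "poly3_deg_le k' (\<lambda>x y z. f x y z * g x y z)"
proof -
  obtain c where c: "\<And>x y z. f x y z = (\<Sum>i\<le>k. \<Sum>j\<le>k - i. \<Sum>l\<le>k - i - j. c i j l * x ^ i * y ^ j * z ^ l)"
    using f unfolding poly3_deg_le_def by blast
  show ?thesis
    unfolding c sum_distrib_right by (intro poly3_sum mono) auto
qed

lemma poly3_mono: "poly3_deg_le k f \<Longrightarrow> k \<le> k' \<Longrightarrow> poly3_deg_le k' f"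
  using poly3_induct_monomials[of k f k' "\<lambda>_ _ _. 1"] poly3_monomial by simp

lemma poly3_mult:
  assumes f: "poly3_deg_le a f" and g: "poly3_deg_le b g"
  shows "poly3_deg_le (a + b) (\<lambda>x y z. f x y z * g x y z)"
proof (rule poly3_induct_monomials[OF f])
  fix c :: real and i j l assume ijl: "i + j + l \<le> a"
  have "poly3_deg_le (a + b) (\<lambda>x y z. g x y z * (c * x ^ i * y ^ j * z ^ l))"
  proof (rule poly3_induct_monomials[OF g])
    fix c' :: real and i' j' l' assume "i' + j' + l' \<le> b"
    hence "poly3_deg_le (a + b) (\<lambda>x y z. c' * c * x ^ (i' + i) * y ^ (j' + j) * z ^ (l' + l))"
      using ijl by (intro poly3_monomial) simp
    thus "poly3_deg_le (a + b) (\<lambda>x y z. c' * x ^ i' * y ^ j' * z ^ l' * (c * x ^ i * y ^ j * z ^ l))"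
      by (simp add: power_add mult_ac)
  qed
  thus "poly3_deg_le (a + b) (\<lambda>x y z. c * x ^ i * y ^ j * z ^ l * g x y z)"
    by (simp add: mult.commute)
qed

lemma poly3_power: "poly3_deg_le k f \<Longrightarrow> poly3_deg_le (k * i) (\<lambda>x y z. f x y z ^ i)"
proof (induction i)
  case 0
  show ?case using poly3_monomial[of 0 0 0 0 1] by simp
next
  case (Suc i)
  thus ?case using poly3_mult[of k f "k * i" "\<lambda>x y z. f x y z ^ i"] by simp
qed

text \<open>Substitution doubles the degree in the first variable only: the term with exponents
  \<open>i\<close> and \<open>j\<close> gets degree \<open>2 * i + j\<close>, at most
  \<open>2 * k\<close>.\<close>

lemma poly3_lift:
  assumes "poly2_deg_le k P"
  shows "poly3_deg_le (2 * k) (\<lambda>x y z. P (x^2 + y^2 - K) z)"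
proof -
  obtain c where c: "\<And>x y. P x y = (\<Sum>i\<le>k. \<Sum>j\<le>k - i. c i j * x ^ i * y ^ j)"
    using assms by (auto simp: poly2_deg_le_def)
  have "poly3_deg_le 2 (\<lambda>x y z. (x^2 + y^2) + - K)"
    using poly3_monomial[of 2 0 0 2 1] poly3_monomial[of 0 2 0 2 1] poly3_monomial[of 0 0 0 2 "-K"]
    by (intro poly3_add) simp_all
  hence r: "poly3_deg_le 2 (\<lambda>x y z. x^2 + y^2 - K)" by simp
  show ?thesis
    unfolding c
  proof (intro poly3_sum)
    fix i j assume ij: "i \<in> {..k}" "j \<in> {..k - i}"
    have "poly3_deg_le (2 * i + j) (\<lambda>x y z. (x^2 + y^2 - K) ^ i * (c i j * z ^ j))"
      by (intro poly3_mult poly3_power r) (use poly3_monomial[of 0 0 j j "c i j"] in simp)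
    hence "poly3_deg_le (2 * k) (\<lambda>x y z. (x^2 + y^2 - K) ^ i * (c i j * z ^ j))"
      by (rule poly3_mono) (use ij in auto)
    thus "poly3_deg_le (2 * k) (\<lambda>x y z. c i j * (x^2 + y^2 - K) ^ i * z ^ j)"
      by (simp add: mult_ac)
  qed
qed

section \<open>Boundedness and counting of cycles\<close>

lemma limit_cycle_bounded: "limit_cycle F Orb \<Longrightarrow> bounded Orb"
proof -
  assume "limit_cycle F Orb"
  then obtain g T where g: "ode_sol F g" "T > 0" "\<And>t. g (t + T) = g t" "Orb = range g"
    unfolding limit_cycle_def periodic_orbit_def periodic_param_def by blast
  have "g t \<in> g ` {0..T}" for t
    using exists_period_representative[OF g(2), of t] periodic_int_shift[of g, OF g(3)]
    by (metis atLeastAtMost_iff imageI less_imp_le)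
  hence "Orb = g ` {0..T}" using g(4) by auto
  thus ?thesis
    using compact_imp_bounded[OF compact_continuous_image[OF ode_sol_continuous_on[OF g(1)] compact_Icc]]
    by simp
qed

text \<open>Passing to a finite subfamily covers the case of infinitely many cycles, and finiteness
  is what allows a single \<open>K\<close> for all of them.\<close>

lemma enat_le_ecount_iff: "enat L \<le> ecount A \<longleftrightarrow> (\<exists>B\<subseteq>A. finite B \<and> card B = L)"
proof
  assume "enat L \<le> ecount A"
  thus "\<exists>B\<subseteq>A. finite B \<and> card B = L"
    by (metis ecount_def enat_ord_simps(1) infinite_arbitrarily_large obtain_subset_with_card_n)
next
  assume "\<exists>B\<subseteq>A. finite B \<and> card B = L"
  thus "enat L \<le> ecount A" by (auto simp: ecount_def intro: card_mono)
qed

theorem theoremB: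
  fixes m L :: nat
  assumes "m \<ge> 2"
    and "\<exists>P Q. poly2_deg_le (m div 2 - 1) P \<and> poly2_deg_le (m div 2 - 1) Q \<and> enat L \<le> pi_h P Q"
  shows "enat L \<le> N_h m"
proof -
  define k where "k = m div 2 - 1"
  \<comment> \<open>The third component has the largest degree bound, \<open>2 * k + 2\<close>: the
    factor \<open>\<rho>\<close> contributes 2 and the substitution \<open>2 * k\<close>.\<close>
  have k: "2 * k + 2 \<le> m" using assms(1) by (simp add: k_def)
  obtain P Q where P: "poly2_deg_le k P" and Q: "poly2_deg_le k Q" and "enat L \<le> pi_h P Q"
    using assms(2) k_def by blast
  then obtain S where S: "S \<subseteq> {Orb. hyperbolic_limit_cycle (field2 P Q) Orb}" "finite S" "card S = L"
    by (auto simp: pi_h_def enat_le_ecount_iff)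
  obtain Pu Pz Qu Qz where C1: "C1_fun2 P Pu Pz" "C1_fun2 Q Qu Qz"
    using poly2_deg_le_C1 P Q by meson
  have "bounded (\<Union>S)"
    using S by (intro bounded_Union) (auto simp: hyperbolic_limit_cycle_def intro: limit_cycle_bounded)
  then obtain B where B: "\<And>v. v \<in> \<Union>S \<Longrightarrow> norm v \<le> B" by (auto simp: bounded_iff)
  \<comment> \<open>On the selected cycles the first coordinate is at least \<open>- B\<close>, so
    \<open>u + K\<close> is at least 1.\<close>
  define K where "K = B + 1"
  have K: "v$1 + K > 0" if "\<Gamma> \<in> S" "v \<in> \<Gamma>" for \<Gamma> v
    using B[of v] component_le_norm_cart[of v 1] that by (force simp: K_def)
  define lift where "lift \<Gamma> = {w :: real^3. vector [(w$1)^2 + (w$2)^2 - K, w$3] \<in> \<Gamma>}" for \<Gamma> :: "(real^2) set"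
  \<comment> \<open>Projecting a torus back to the plane recovers its cycle; every point of the
    cycle is hit because \<open>u + K\<close> is positive there.\<close>
  have "inj_on lift S"
  proof (rule inj_on_inverseI)
    fix \<Gamma> assume \<Gamma>: "\<Gamma> \<in> S"
    have "v \<in> (\<lambda>w. vector [(w$1)^2 + (w$2)^2 - K, w$3]) ` lift \<Gamma>" if v: "v \<in> \<Gamma>" for v
    proof
      \<comment> \<open>The point of the torus over \<open>v\<close> at angle zero.\<close>
      define w :: "real^3" where "w = vector [sqrt (v$1 + K), 0, v$2]"
      show "v = vector [(w$1)^2 + (w$2)^2 - K, w$3]"
        using K[OF \<Gamma> v] by (simp add: w_def vec_eq_iff forall_2)
      thus "w \<in> lift \<Gamma>" using v by (simp add: lift_def)
    qed
    thus "(\<lambda>w. vector [(w$1)^2 + (w$2)^2 - K, w$3]) ` lift \<Gamma> = \<Gamma>" by (auto simp: lift_def)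
  qed
  hence "card (lift ` S) = L" using S(3) by (simp add: card_image)
  define P' Q' R' where "P' x y z = - y + x * P (x^2 + y^2 - K) z"
    and "Q' x y z = x + y * P (x^2 + y^2 - K) z"
    and "R' x y z = 2 * (x^2 + y^2) * Q (x^2 + y^2 - K) z" for x y z
  have field: "lifted_field P Q K = field3 P' Q' R'"
    by (simp add: lifted_field_def P'_def[abs_def] Q'_def[abs_def] R'_def[abs_def])
  have "nh_invariant_torus (field3 P' Q' R') (lift \<Gamma>)" if "\<Gamma> \<in> S" for \<Gamma>
    unfolding field[symmetric] lift_def
    by (rule nh_invariant_torus_lift[OF C1]) (use S K that in auto)
  hence "enat L \<le> tau_h P' Q' R'"
    unfolding tau_h_def enat_le_ecount_iff using S(2) \<open>card (lift ` S) = L\<close> by blast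
  moreover have "poly3_deg_le m P'" "poly3_deg_le m Q'" "poly3_deg_le m R'"
  proof -
    have x: "poly3_deg_le d (\<lambda>x y z. c * x)" and y: "poly3_deg_le d (\<lambda>x y z. c * y)" if "d \<ge> 1" for c d
      using poly3_monomial[of 1 0 0 d c] poly3_monomial[of 0 1 0 d c] that by simp_all
    have "poly3_deg_le (1 + 2 * k) (\<lambda>x y z. -1 * y + (1 * x) * P (x^2 + y^2 - K) z)"
      "poly3_deg_le (1 + 2 * k) (\<lambda>x y z. 1 * x + (1 * y) * P (x^2 + y^2 - K) z)"
      by (intro poly3_add poly3_mult x y poly3_lift P; simp)+
    thus "poly3_deg_le m P'" "poly3_deg_le m Q'"
      unfolding P'_def[abs_def] Q'_def[abs_def] using k
      by (simp_all add: poly3_mono[of "1 + 2 * k"])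
    have "poly3_deg_le 2 (\<lambda>x y z. 2 * x^2 + 2 * y^2)"
      using poly3_monomial[of 2 0 0 2 2] poly3_monomial[of 0 2 0 2 2] by (intro poly3_add) simp_all
    from poly3_mult[OF this poly3_lift[OF Q, of K]]
    have "poly3_deg_le (2 + 2 * k) R'" by (simp add: R'_def[abs_def] distrib_left)
    thus "poly3_deg_le m R'" by (rule poly3_mono) (use k in simp)
  qed
  ultimately show ?thesis
    unfolding N_h_def by (intro Sup_upper2[of "tau_h P' Q' R'"]) auto
qed

end
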